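(* Let $n\ge 2$, let $\mathcal{H}_1,\dots,\mathcal{H}_n$ be infinite dimensional complex Hilbert spaces, and let $D_s\in\mathcal{B}(\mathcal{H}_s)$ for $1\le s\le n$. Consider the following statements. (i) Both of the following hold: (a) $D_n\in\Phi_-(\mathcal{H}_n)$; (b) either [$\mathcal{R}(D_s)$ is closed for $1\le s\le n-1$ and $\beta(D_s)\le\alpha(D_{s+1})$ for $1\le s\le n-1$], or [$D_s\in\Phi_-(\mathcal{H}_s)$ for $1\le s\le n-1$]. (ii) There exists $A\in\mathcal{B}_n$ such that $T_n^d(A)\in\Phi_-(\mathcal{H}_1\oplus\cdots\oplus\mathcal{H}_n)$. (iii) Both of the following hold: (a) $D_n\in\Phi_-(\mathcal{H}_n)$; (b) either [there is $j\in\{2,\dots,n\}$ such that $\alpha(D_j)=\infty$ and $\beta(D_s)<\infty$ for $j\le s\le n-1$ (the last condition being omitted if $j=n$)], or [$D_s\in\Phi_-(\mathcal{H}_s)$ for $1\le s\le n-1$]. Then (i) $\Rightarrow$ (ii) $\Rightarrow$ (iii).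
   Context: $\mathcal{B}(\mathcal{H},\mathcal{K})$ is the space of bounded linear operators from $\mathcal{H}$ to $\mathcal{K}$, and $\mathcal{B}(\mathcal{H})=\mathcal{B}(\mathcal{H},\mathcal{H})$. $\mathcal{N}(T)$ and $\mathcal{R}(T)$ are the kernel and range of $T$. $\mathcal{B}_n$ is the set of all tuples $A=(A_{ij})_{1\le i<j\le n}$ with $A_{ij}\in\mathcal{B}(\mathcal{H}_j,\mathcal{H}_i)$. Given $D_1,\dots,D_n$ and $A\in\mathcal{B}_n$, $T_n^d(A)\in\mathcal{B}(\mathcal{H}_1\oplus\cdots\oplus\mathcal{H}_n)$ is the upper triangular block operator matrix with diagonal entries $D_1,\dots,D_n$, entry $A_{ij}$ in position $(i,j)$ for $i<j$, and $0$ in position $(i,j)$ for $i>j$. For $T\in\mathcal{B}(\mathcal{H})$: $\alpha(T)=\dim\mathcal{N}(T)$ and $\beta(T)=\dim\mathcal{H}/\mathcal{R}(T)$. Dimensions of Hilbert spaces are Hilbert (orthogonal) dimensions, compared as cardinals; thus $\beta(T)$ is the Hilbert dimension of $\mathcal{R}(T)^\perp$ if $\mathcal{R}(T)$ is closed, while if $\mathcal{R}(T)$ is not closed $\beta(T)$ is the algebraic dimension of the quotient, which is infinite. "$=\infty$" means infinite and "$<\infty$" means finite. $\Phi_-(\mathcal{H})=\{T\in\mathcal{B}(\mathcal{H}):\beta(T)<\infty\}$. *)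

theory Defs
  imports "HOL-Analysis.Analysis" "HOL-Algebra.Algebraic_Closure_Type"
begin

unbundle cardinal_syntax

text \<open>
  A Hilbert space is a structure with an explicit carrier set. A family of Hilbert spaces
  indexed by numbers therefore only has to share the type of its elements, and finite
  direct sums can be formed for a variable number of summands. The fields
  \<^term>\<open>monoid.mult\<close> and \<^term>\<open>one\<close> that HOL-Algebra modules inherit from rings
  play no role.
\<close>

record 'a hilbert = "(complex, 'a) module" +
  cinner :: "'a \<Rightarrow> 'a \<Rightarrow> complex"

definition hnorm :: "'a hilbert \<Rightarrow> 'a \<Rightarrow> real" where
  "hnorm H x = sqrt (Re (cinner H x x))"

text \<open>The locale \<^locale>\<open>Metric_space\<close> requires its distance to be symmetric and nonnegative
  also outside the carrier, hence the case distinction.\<close>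

definition hdist :: "'a hilbert \<Rightarrow> 'a \<Rightarrow> 'a \<Rightarrow> real" where
  "hdist H x y =
     (if x \<in> carrier H \<and> y \<in> carrier H then hnorm H (x \<ominus>\<^bsub>H\<^esub> y) else 0)"

locale complex_hilbert_space =
  Module.module "ring_of_type_algebra :: complex ring" H for H :: "'a hilbert" (structure) +
  assumes cinner_add_left:
      "\<lbrakk>x \<in> carrier H; y \<in> carrier H; z \<in> carrier H\<rbrakk> \<Longrightarrow>
       cinner H (x \<oplus> y) z = cinner H x z + cinner H y z"
    and cinner_smult_left:
      "\<lbrakk>x \<in> carrier H; y \<in> carrier H\<rbrakk> \<Longrightarrow> cinner H (c \<odot> x) y = c * cinner H x y"
    and cinner_commute:
      "\<lbrakk>x \<in> carrier H; y \<in> carrier H\<rbrakk> \<Longrightarrow> cinner H x y = cnj (cinner H y x)"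
    and cinner_ge_zero: "x \<in> carrier H \<Longrightarrow> 0 \<le> Re (cinner H x x)"
    and cinner_eq_zeroD: "\<lbrakk>x \<in> carrier H; cinner H x x = 0\<rbrakk> \<Longrightarrow> x = \<zero>"
    and complete: "Metric_space.mcomplete (carrier H) (hdist H)"

definition hclosed :: "'a hilbert \<Rightarrow> 'a set \<Rightarrow> bool" where
  "hclosed H S \<longleftrightarrow> closedin (Metric_space.mtopology (carrier H) (hdist H)) S"

definition orth_compl :: "'a hilbert \<Rightarrow> 'a set \<Rightarrow> 'a set" where
  "orth_compl H S = {x \<in> carrier H. \<forall>y\<in>S. cinner H x y = 0}"

definition orthonormal :: "'a hilbert \<Rightarrow> 'a set \<Rightarrow> bool" where
  "orthonormal H B \<longleftrightarrow> B \<subseteq> carrier H \<and>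
     (\<forall>x\<in>B. \<forall>y\<in>B. cinner H x y = (if x = y then 1 else 0))"

definition orthonormal_basis :: "'a hilbert \<Rightarrow> 'a set \<Rightarrow> 'a set \<Rightarrow> bool" where
  "orthonormal_basis H S B \<longleftrightarrow> B \<subseteq> S \<and> orthonormal H B \<and>
     (\<forall>B'. B \<subseteq> B' \<and> B' \<subseteq> S \<and> orthonormal H B' \<longrightarrow> B' = B)"

text \<open>The Hilbert dimension of a closed subspace \<open>S\<close>, as a cardinal; all orthonormal bases
  have the same cardinality.\<close>

definition hilbert_dim :: "'a hilbert \<Rightarrow> 'a set \<Rightarrow> 'a rel" where
  "hilbert_dim H S = |SOME B. orthonormal_basis H S B|"

definition infinite_dimensional :: "'a hilbert \<Rightarrow> bool" where
  "infinite_dimensional H \<longleftrightarrow> cinfinite (hilbert_dim H (carrier H))"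

text \<open>\<open>B\<close> is a set of representatives, one for each basis vector, of an algebraic (Hamel) basis
  of the quotient of \<open>H\<close> by the subspace \<open>S\<close>. Linear independence modulo \<open>S\<close> forces distinct
  elements of \<open>B\<close> to have distinct cosets.\<close>

definition quotient_basis :: "'a hilbert \<Rightarrow> 'a set \<Rightarrow> 'a set \<Rightarrow> bool" where
  "quotient_basis H S B \<longleftrightarrow> B \<subseteq> carrier H \<and>
     (\<forall>F c. finite F \<and> F \<subseteq> B \<and> (\<Oplus>\<^bsub>H\<^esub>b\<in>F. c b \<odot>\<^bsub>H\<^esub> b) \<in> S \<longrightarrow> (\<forall>b\<in>F. c b = 0)) \<and>
     (\<forall>x\<in>carrier H. \<exists>F c. finite F \<and> F \<subseteq> B \<and> x \<ominus>\<^bsub>H\<^esub> (\<Oplus>\<^bsub>H\<^esub>b\<in>F. c b \<odot>\<^bsub>H\<^esub> b) \<in> S)"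

definition quotient_dim :: "'a hilbert \<Rightarrow> 'a set \<Rightarrow> 'a rel" where
  "quotient_dim H S = |SOME B. quotient_basis H S B|"

text \<open>Operators are only constrained on the carrier of their domain.\<close>

definition bounded_ops :: "'a hilbert \<Rightarrow> 'b hilbert \<Rightarrow> ('a \<Rightarrow> 'b) set" where
  "bounded_ops H K = {T \<in> carrier H \<rightarrow> carrier K.
     (\<forall>x\<in>carrier H. \<forall>y\<in>carrier H. T (x \<oplus>\<^bsub>H\<^esub> y) = T x \<oplus>\<^bsub>K\<^esub> T y) \<and>
     (\<forall>c. \<forall>x\<in>carrier H. T (c \<odot>\<^bsub>H\<^esub> x) = c \<odot>\<^bsub>K\<^esub> T x) \<and>
     (\<exists>C. \<forall>x\<in>carrier H. hnorm K (T x) \<le> C * hnorm H x)}"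

abbreviation op_range :: "'a hilbert \<Rightarrow> ('a \<Rightarrow> 'a) \<Rightarrow> 'a set" where
  "op_range H T \<equiv> T ` carrier H"

definition nullity :: "'a hilbert \<Rightarrow> ('a \<Rightarrow> 'a) \<Rightarrow> 'a rel" where
  "nullity H T = hilbert_dim H (a_kernel H H T)"

text \<open>The dimension of the quotient by the range is a Hilbert dimension if the range is closed,
  and an algebraic one (then infinite) otherwise.\<close>

definition deficiency :: "'a hilbert \<Rightarrow> ('a \<Rightarrow> 'a) \<Rightarrow> 'a rel" where
  "deficiency H T =
     (if hclosed H (op_range H T) then hilbert_dim H (orth_compl H (op_range H T))
      else quotient_dim H (op_range H T))"

definition Phi_minus :: "'a hilbert \<Rightarrow> ('a \<Rightarrow> 'a) set" where
  "Phi_minus H = {T \<in> bounded_ops H H. BNF_Cardinal_Arithmetic.cfinite (deficiency H T)}"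

definition direct_sum :: "nat \<Rightarrow> (nat \<Rightarrow> 'a hilbert) \<Rightarrow> (nat \<Rightarrow> 'a) hilbert" where
  "direct_sum n H =
    \<lparr>carrier = (\<Pi>\<^sub>E i\<in>{1..n}. carrier (H i)),
     monoid.mult = (\<lambda>_ _. undefined),
     one = undefined,
     ring.zero = (\<lambda>i\<in>{1..n}. \<zero>\<^bsub>H i\<^esub>),
     add = (\<lambda>x y. \<lambda>i\<in>{1..n}. x i \<oplus>\<^bsub>H i\<^esub> y i),
     smult = (\<lambda>c x. \<lambda>i\<in>{1..n}. c \<odot>\<^bsub>H i\<^esub> x i),
     cinner = (\<lambda>x y. \<Sum>i\<in>{1..n}. cinner (H i) (x i) (y i))\<rparr>"

text \<open>Only the entries \<open>A i j\<close> with \<open>1 \<le> i < j \<le> n\<close> matter.\<close>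

definition upper_tuples :: "nat \<Rightarrow> (nat \<Rightarrow> 'a hilbert) \<Rightarrow> (nat \<Rightarrow> nat \<Rightarrow> 'a \<Rightarrow> 'a) set" where
  "upper_tuples n H = {A. \<forall>i j. 1 \<le> i \<and> i < j \<and> j \<le> n \<longrightarrow> A i j \<in> bounded_ops (H j) (H i)}"

definition upper_entry ::
  "(nat \<Rightarrow> 'a hilbert) \<Rightarrow> (nat \<Rightarrow> 'a \<Rightarrow> 'a) \<Rightarrow> (nat \<Rightarrow> nat \<Rightarrow> 'a \<Rightarrow> 'a) \<Rightarrow>
   nat \<Rightarrow> nat \<Rightarrow> 'a \<Rightarrow> 'a" where
  "upper_entry H D A i j =
     (if i = j then D i else if i < j then A i j else (\<lambda>_. \<zero>\<^bsub>H i\<^esub>))"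

definition upper_triangular_op ::
  "nat \<Rightarrow> (nat \<Rightarrow> 'a hilbert) \<Rightarrow> (nat \<Rightarrow> 'a \<Rightarrow> 'a) \<Rightarrow> (nat \<Rightarrow> nat \<Rightarrow> 'a \<Rightarrow> 'a) \<Rightarrow>
   (nat \<Rightarrow> 'a) \<Rightarrow> (nat \<Rightarrow> 'a)" where
  "upper_triangular_op n H D A =
     (\<lambda>x. \<lambda>i\<in>{1..n}. \<Oplus>\<^bsub>H i\<^esub>j\<in>{1..n}. upper_entry H D A i j (x j))"

end

theory Submission
  imports Defs
begin

text \<open>
  The finiteness of a deficiency is a purely algebraic condition. If the range is closed, an
  orthonormal basis of its orthogonal complement is independent modulo the range and, by the
  projection theorem, spans a complement as soon as it is finite; if the range is not closed, the
  deficiency is an algebraic codimension by definition. So \<open>T\<close> lies in \<open>\<Phi>\<^sub>-\<close> if and only if the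
  range of \<open>T\<close> has finite algebraic codimension (lemma \<open>cfinite_deficiency_iff\<close>). Everything about
  block operators then becomes linear algebra modulo finite dimensional spaces, organised around the
  relation \<open>almost_below H U S\<close>: \<open>U\<close> is contained in \<open>S\<close> enlarged by finitely many vectors. This
  relation is transitive and compatible with sums, images and preimages under linear maps.

  Necessity. Let the range of the triangular operator \<open>T\<close> have finite codimension and suppose that
  \<open>D\<^sub>j\<close> has a finite dimensional kernel for all \<open>j > k\<close>. Solving the equations \<open>(T x)\<^sub>i = 0\<close> for
  \<open>i = n, n-1, \<dots>, k+1\<close> one after the other shows that, up to a finite dimensional space, their
  solutions are supported in the first \<open>k\<close> coordinates, where \<open>(T x)\<^sub>k = D\<^sub>k x\<^sub>k\<close>. The vectors
  of \<open>H\<^sub>k\<close> that \<open>T\<close> reaches in the direct sum have finite codimension in \<open>H\<^sub>k\<close>, so \<open>D\<^sub>k\<close> has a range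
  of finite codimension (lemma \<open>diag_finite_codim\<close>). For \<open>k = n\<close> the assumption on kernels is void.
  Descending from \<open>n\<close>, either all deficiencies are finite, or the descent is stopped by an infinite
  dimensional kernel at some \<open>j\<close>, with finite deficiencies from \<open>j\<close> onwards.

  Sufficiency. Only the entries next to the diagonal are needed. If \<open>D\<^sub>s\<close> has a closed range and
  \<open>\<beta>(D\<^sub>s) \<le> \<alpha>(D\<^sub>s\<^sub>+\<^sub>1)\<close>, matching an orthonormal basis of the complement of the range with part of
  an orthonormal basis of the kernel gives, by the Riesz-Fischer theorem, a bounded operator from
  \<open>H\<^sub>s\<^sub>+\<^sub>1\<close> to \<open>H\<^sub>s\<close> that maps the kernel of \<open>D\<^sub>s\<^sub>+\<^sub>1\<close> onto this complement (lemma
  \<open>bounded_op_onto\<close>). With these entries, or with zero entries if all \<open>D\<^sub>s\<close> are in \<open>\<Phi>\<^sub>-\<close>, the range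
  of \<open>T\<close> meets every summand in a subspace of finite codimension (lemma
  \<open>bidiagonal_finite_codim\<close>).
\<close>

section \<open>Inner product spaces and linear algebra modulo a subspace\<close>

text \<open>The axioms of a Hilbert space without completeness: the completeness of a direct sum can only be
  proved once its norm is known to behave like one.\<close>

locale complex_prehilbert_space =
  Module.module "ring_of_type_algebra :: complex ring" H for H :: "'a hilbert" (structure) +
  assumes cinner_add_left:
      "\<lbrakk>x \<in> carrier H; y \<in> carrier H; z \<in> carrier H\<rbrakk> \<Longrightarrow>
       cinner H (x \<oplus> y) z = cinner H x z + cinner H y z"
    and cinner_smult_left:
      "\<lbrakk>x \<in> carrier H; y \<in> carrier H\<rbrakk> \<Longrightarrow> cinner H (c \<odot> x) y = c * cinner H x y"
    and cinner_commute:
      "\<lbrakk>x \<in> carrier H; y \<in> carrier H\<rbrakk> \<Longrightarrow> cinner H x y = cnj (cinner H y x)"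
    and cinner_ge_zero: "x \<in> carrier H \<Longrightarrow> 0 \<le> Re (cinner H x x)"
    and cinner_eq_zeroD: "\<lbrakk>x \<in> carrier H; cinner H x x = 0\<rbrakk> \<Longrightarrow> x = \<zero>"

sublocale complex_hilbert_space \<subseteq> complex_prehilbert_space
  by unfold_locales
    (fact cinner_add_left cinner_smult_left cinner_commute cinner_ge_zero cinner_eq_zeroD)+

abbreviation subspace_of :: "'a hilbert \<Rightarrow> 'a set \<Rightarrow> bool" where
  "subspace_of H S \<equiv> submodule S (ring_of_type_algebra :: complex ring) H"

text \<open>The algebraic part of \<^const>\<open>bounded_ops\<close>; coordinate projections and inclusions of
  summands only enter through their linearity.\<close>

definition linear_ops :: "'a hilbert \<Rightarrow> 'b hilbert \<Rightarrow> ('a \<Rightarrow> 'b) set" where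
  "linear_ops H K = {T \<in> carrier H \<rightarrow> carrier K.
     (\<forall>x\<in>carrier H. \<forall>y\<in>carrier H. T (x \<oplus>\<^bsub>H\<^esub> y) = T x \<oplus>\<^bsub>K\<^esub> T y) \<and>
     (\<forall>c. \<forall>x\<in>carrier H. T (c \<odot>\<^bsub>H\<^esub> x) = c \<odot>\<^bsub>K\<^esub> T x)}"

lemma bounded_ops_linear: "T \<in> bounded_ops H K \<Longrightarrow> T \<in> linear_ops H K"
  by (auto simp: bounded_ops_def linear_ops_def)

context complex_prehilbert_space
begin

lemma smult_in [simp, intro]: "x \<in> carrier H \<Longrightarrow> c \<odot> x \<in> carrier H"
  using smult_closed[of c x] by (simp add: ring_of_type_algebra_def)

lemma cinner_zero_left [simp]: "z \<in> carrier H \<Longrightarrow> cinner H \<zero> z = 0"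
  using cinner_add_left[of \<zero> \<zero> z] by simp

lemma cinner_uminus_left: "x \<in> carrier H \<Longrightarrow> z \<in> carrier H \<Longrightarrow> cinner H (\<ominus> x) z = - cinner H x z"
  using cinner_add_left[of "\<ominus> x" x z] by (simp add: l_neg add_eq_0_iff)

lemma cinner_diff_left:
  "x \<in> carrier H \<Longrightarrow> y \<in> carrier H \<Longrightarrow> z \<in> carrier H \<Longrightarrow>
   cinner H (x \<ominus> y) z = cinner H x z - cinner H y z"
  by (simp add: minus_eq cinner_add_left cinner_uminus_left)

lemma cinner_finsum_left:
  assumes "finite F" "f \<in> F \<rightarrow> carrier H" "z \<in> carrier H"
  shows "cinner H (\<Oplus>i\<in>F. f i) z = (\<Sum>i\<in>F. cinner H (f i) z)"
  using assms by (induct F) (auto simp: cinner_add_left Pi_def)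

lemmas cinner_left = cinner_add_left cinner_smult_left cinner_uminus_left cinner_diff_left

lemma cinner_right:
  "x \<in> carrier H \<Longrightarrow> y \<in> carrier H \<Longrightarrow> z \<in> carrier H \<Longrightarrow>
     cinner H z (x \<oplus> y) = cinner H z x + cinner H z y"
  "x \<in> carrier H \<Longrightarrow> y \<in> carrier H \<Longrightarrow> z \<in> carrier H \<Longrightarrow>
     cinner H z (x \<ominus> y) = cinner H z x - cinner H z y"
  "x \<in> carrier H \<Longrightarrow> z \<in> carrier H \<Longrightarrow> cinner H z (c \<odot> x) = cnj c * cinner H z x"
  "z \<in> carrier H \<Longrightarrow> cinner H z \<zero> = 0"
  by (auto simp: cinner_commute[of z] cinner_left)

text \<open>Vectors are separated by inner products, which turns every identity between linear
  combinations into one between complex numbers.\<close>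

lemma cinner_ext:
  assumes "x \<in> carrier H" "y \<in> carrier H"
    and "\<And>z. z \<in> carrier H \<Longrightarrow> cinner H x z = cinner H y z"
  shows "x = y"
proof -
  have "cinner H (x \<ominus> y) (x \<ominus> y) = 0"
    using assms by (simp add: cinner_diff_left)
  then have "x \<ominus> y = \<zero>" using assms cinner_eq_zeroD by simp
  then have "\<ominus> (\<ominus> y) = x" using assms by (intro minus_equality) (simp_all add: minus_eq)
  then show ?thesis using assms by simp
qed

lemma diff_zero: "x \<in> carrier H \<Longrightarrow> x \<ominus> \<zero> = x"
  by (rule cinner_ext) (auto simp: cinner_left)

lemma smult_simps [simp]:
  "x \<in> carrier H \<Longrightarrow> 0 \<odot> x = \<zero>"
  "x \<in> carrier H \<Longrightarrow> 1 \<odot> x = x"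
  "c \<odot> \<zero> = \<zero>"
  "x \<in> carrier H \<Longrightarrow> c \<odot> (d \<odot> x) = (c * d) \<odot> x"
  by (rule cinner_ext; simp add: cinner_left)+

lemma subspaceI:
  assumes "S \<subseteq> carrier H" "\<zero> \<in> S" "\<And>x y. x \<in> S \<Longrightarrow> y \<in> S \<Longrightarrow> x \<oplus> y \<in> S"
    and "\<And>c x. x \<in> S \<Longrightarrow> c \<odot> x \<in> S"
  shows "subspace_of H S"
proof (rule submoduleI)
  fix x assume x: "x \<in> S"
  have "\<ominus> x = (-1) \<odot> x"
    using x assms(1) by (intro cinner_ext) (auto simp: cinner_left)
  then show "\<ominus> x \<in> S" using assms(4) x by simp
qed (use assms in auto)

lemma subspaceD:
  assumes "subspace_of H S"
  shows "S \<subseteq> carrier H" "x \<in> S \<Longrightarrow> x \<in> carrier H" "\<zero> \<in> S" "x \<in> S \<Longrightarrow> y \<in> S \<Longrightarrow> x \<oplus> y \<in> S"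
    "x \<in> S \<Longrightarrow> y \<in> S \<Longrightarrow> x \<ominus> y \<in> S" "x \<in> S \<Longrightarrow> c \<odot> x \<in> S"
proof -
  note E = submoduleE[OF assms]
  show sub: "S \<subseteq> carrier H" by (rule E(1))
  show "x \<in> S \<Longrightarrow> x \<in> carrier H" using sub by auto
  show sm: "x \<in> S \<Longrightarrow> c \<odot> x \<in> S" for c x using E(4)[of c x] by (simp add: ring_of_type_algebra_def)
  show "x \<in> S \<Longrightarrow> y \<in> S \<Longrightarrow> x \<oplus> y \<in> S" by (rule E(5))
  show "x \<in> S \<Longrightarrow> y \<in> S \<Longrightarrow> x \<ominus> y \<in> S" using E(3)[of y] E(5)[of x "\<ominus> y"] by (simp add: minus_eq)
  obtain z where z: "z \<in> S" using E(2) by auto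
  then have "0 \<odot> z = \<zero>" using sub by auto
  then show "\<zero> \<in> S" using sm[OF z, of 0] by simp
qed

lemma subspace_carrier: "subspace_of H (carrier H)"
  by (rule subspaceI) auto

lemma subspace_finsum:
  assumes "subspace_of H S" "finite F" "f \<in> F \<rightarrow> S"
  shows "(\<Oplus>i\<in>F. f i) \<in> S"
  using assms(2,3)
proof (induct F)
  case empty show ?case using subspaceD[OF assms(1)] by simp
next
  case (insert x F)
  then have "f \<in> F \<rightarrow> carrier H" "f x \<in> carrier H" using subspaceD(1)[OF assms(1)] by auto
  with insert show ?case using subspaceD(4)[OF assms(1)] by simp
qed

end

lemma linear_opsD:
  assumes "T \<in> linear_ops H K"
  shows "x \<in> carrier H \<Longrightarrow> T x \<in> carrier K"
    "x \<in> carrier H \<Longrightarrow> y \<in> carrier H \<Longrightarrow> T (x \<oplus>\<^bsub>H\<^esub> y) = T x \<oplus>\<^bsub>K\<^esub> T y"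
    "x \<in> carrier H \<Longrightarrow> T (c \<odot>\<^bsub>H\<^esub> x) = c \<odot>\<^bsub>K\<^esub> T x"
  using assms by (auto simp: linear_ops_def)

lemma linear_ops_zero:
  assumes "T \<in> linear_ops H K" "complex_prehilbert_space H" "complex_prehilbert_space K"
  shows "T \<zero>\<^bsub>H\<^esub> = \<zero>\<^bsub>K\<^esub>"
proof -
  interpret H: complex_prehilbert_space H by fact
  interpret K: complex_prehilbert_space K by fact
  show ?thesis using linear_opsD(3)[OF assms(1), of "\<zero>\<^bsub>H\<^esub>" 0] linear_opsD(1)[OF assms(1), of "\<zero>\<^bsub>H\<^esub>"] by simp
qed

lemma linear_ops_diff:
  assumes "T \<in> linear_ops H K" "complex_prehilbert_space H" "complex_prehilbert_space K"
    "x \<in> carrier H" "y \<in> carrier H"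
  shows "T (x \<ominus>\<^bsub>H\<^esub> y) = T x \<ominus>\<^bsub>K\<^esub> T y"
proof -
  interpret H: complex_prehilbert_space H by fact
  interpret K: complex_prehilbert_space K by fact
  note D = linear_opsD[OF assms(1)]
  have "x \<ominus>\<^bsub>H\<^esub> y = x \<oplus>\<^bsub>H\<^esub> (-1) \<odot>\<^bsub>H\<^esub> y"
    using assms by (intro H.cinner_ext) (auto simp: H.cinner_left)
  moreover have "T x \<ominus>\<^bsub>K\<^esub> T y = T x \<oplus>\<^bsub>K\<^esub> (-1) \<odot>\<^bsub>K\<^esub> T y"
    using assms D by (intro K.cinner_ext) (auto simp: K.cinner_left)
  ultimately show ?thesis using assms D by simp
qed

lemma subspace_image:
  assumes "T \<in> linear_ops H K" "complex_prehilbert_space H" "complex_prehilbert_space K" "subspace_of H S"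
  shows "subspace_of K (T ` S)"
proof -
  interpret H: complex_prehilbert_space H by fact
  interpret K: complex_prehilbert_space K by fact
  note D = linear_opsD[OF assms(1)] and S = H.subspaceD[OF assms(4)]
  show ?thesis
  proof (rule K.subspaceI)
    show "T ` S \<subseteq> carrier K" using D S by auto
    show "\<zero>\<^bsub>K\<^esub> \<in> T ` S" using linear_ops_zero[OF assms(1-3)] S(3) by (metis imageI)
    show "x \<oplus>\<^bsub>K\<^esub> y \<in> T ` S" if "x \<in> T ` S" "y \<in> T ` S" for x y
      using that D(2) S by (auto simp flip: D(2))
    show "c \<odot>\<^bsub>K\<^esub> x \<in> T ` S" if "x \<in> T ` S" for c x
      using that S by (auto simp flip: D(3))
  qed
qed

lemma subspace_vimage:
  assumes "T \<in> linear_ops H K" "complex_prehilbert_space H" "complex_prehilbert_space K"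
    "subspace_of H Z" "subspace_of K S"
  shows "subspace_of H {x \<in> Z. T x \<in> S}"
proof -
  interpret H: complex_prehilbert_space H by fact
  interpret K: complex_prehilbert_space K by fact
  note D = linear_opsD[OF assms(1)] and Z = H.subspaceD[OF assms(4)] and S = K.subspaceD[OF assms(5)]
  show ?thesis
    by (rule H.subspaceI) (use Z S in \<open>auto simp: linear_ops_zero[OF assms(1-3)] D\<close>)
qed

section \<open>Containment up to finite dimension\<close>

definition adjoin :: "'a hilbert \<Rightarrow> 'a set \<Rightarrow> 'a \<Rightarrow> 'a set" where
  "adjoin H S v = {s \<oplus>\<^bsub>H\<^esub> c \<odot>\<^bsub>H\<^esub> v |s c. s \<in> S}"

text \<open>\<open>U\<close> lies in the sum of \<open>S\<close> and the span of finitely many vectors. The vectors are adjoined to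
  \<open>S\<close> one at a time, so that each compatibility property below is an induction whose step concerns a
  single vector.\<close>

inductive almost_below :: "'a hilbert \<Rightarrow> 'a set \<Rightarrow> 'a set \<Rightarrow> bool" for H U where
  below: "U \<subseteq> S \<Longrightarrow> almost_below H U S"
| step: "\<lbrakk>v \<in> carrier H; almost_below H U (adjoin H S v)\<rbrakk> \<Longrightarrow> almost_below H U S"

lemma adjoin_mono: "S \<subseteq> S' \<Longrightarrow> adjoin H S v \<subseteq> adjoin H S' v"
  by (auto simp: adjoin_def)

lemma almost_below_mono_right: "almost_below H U S \<Longrightarrow> S \<subseteq> S' \<Longrightarrow> almost_below H U S'"
proof (induct arbitrary: S' rule: almost_below.induct)
  case (below S) then show ?case by (blast intro: almost_below.below)
next
  case (step v S)
  show ?case by (rule almost_below.step[OF step(1) step(3)[OF adjoin_mono[OF step(4)]]])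
qed

lemma almost_below_mono_left: "almost_below H U S \<Longrightarrow> U' \<subseteq> U \<Longrightarrow> almost_below H U' S"
proof (induct rule: almost_below.induct)
  case (below S) then show ?case by (blast intro: almost_below.below)
next
  case (step v S) then show ?case by (blast intro: almost_below.step)
qed

context complex_prehilbert_space
begin

lemma adjoin_subset: "S \<subseteq> carrier H \<Longrightarrow> v \<in> carrier H \<Longrightarrow> adjoin H S v \<subseteq> carrier H"
  by (auto simp: adjoin_def)

lemma subset_adjoin: assumes "S \<subseteq> carrier H" "v \<in> carrier H" shows "S \<subseteq> adjoin H S v"
proof
  fix x assume "x \<in> S"
  moreover from this have "x = x \<oplus> 0 \<odot> v" using assms by auto
  ultimately show "x \<in> adjoin H S v" unfolding adjoin_def by blast
qed

lemma subspace_adjoin: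
  assumes "subspace_of H S" "v \<in> carrier H"
  shows "subspace_of H (adjoin H S v)"
proof (rule subspaceI)
  note S = subspaceD[OF assms(1)]
  show "adjoin H S v \<subseteq> carrier H" using adjoin_subset S assms by blast
  show "\<zero> \<in> adjoin H S v" using subset_adjoin S assms by blast
  fix x assume "x \<in> adjoin H S v"
  then obtain s c where x: "s \<in> S" "x = s \<oplus> c \<odot> v" by (auto simp: adjoin_def)
  note sc = S(2)[OF x(1)]
  show "d \<odot> x \<in> adjoin H S v" for d
  proof -
    have "d \<odot> x = d \<odot> s \<oplus> (d * c) \<odot> v"
      using x sc assms by (intro cinner_ext) (auto simp: cinner_left algebra_simps)
    then show ?thesis using S(6)[OF x(1)] by (auto simp: adjoin_def)
  qed
  fix y assume "y \<in> adjoin H S v"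
  then obtain t d where y: "t \<in> S" "y = t \<oplus> d \<odot> v" by (auto simp: adjoin_def)
  note tc = S(2)[OF y(1)]
  have "x \<oplus> y = (s \<oplus> t) \<oplus> (c + d) \<odot> v"
    using x y sc tc assms by (intro cinner_ext) (auto simp: cinner_left algebra_simps)
  then show "x \<oplus> y \<in> adjoin H S v" using S(4)[OF x(1) y(1)] by (auto simp: adjoin_def)
qed

lemma almost_below_adjoin:
  assumes "almost_below H U S" "S \<subseteq> carrier H" "v \<in> carrier H"
  shows "almost_below H (adjoin H U v) S"
  using assms
proof (induct rule: almost_below.induct)
  case (below S)
  show ?case
    by (rule almost_below.step[OF below(3)], rule almost_below.below, rule adjoin_mono, rule below(1))
next
  case (step w S)
  show ?case
    by (rule almost_below.step[OF step(1)], rule step(3)[OF adjoin_subset[OF step(4,1)] step(5)])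
qed

lemma almost_below_trans:
  assumes "almost_below H U S" "almost_below H S R" "R \<subseteq> carrier H"
  shows "almost_below H U R"
  using assms
proof (induct rule: almost_below.induct)
  case (below S)
  then show ?case using almost_below_mono_left by metis
next
  case (step v S)
  show ?case by (rule step(3)[OF almost_below_adjoin[OF step(4,5,1)] step(5)])
qed

lemma almost_below_sum:
  assumes "almost_below H U1 S" "almost_below H U2 S" "subspace_of H S"
    and "\<And>x. x \<in> U \<Longrightarrow> \<exists>u1\<in>U1. \<exists>u2\<in>U2. x = u1 \<oplus> u2"
  shows "almost_below H U S"
  using assms(1-3)
proof (induct rule: almost_below.induct)
  case (below S)
  from below(2,1,3) show ?case
  proof (induct rule: almost_below.induct)
    case (below S)
    have "U \<subseteq> S" using assms(4) below subspaceD(4)[OF below(3)] by blast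
    then show ?case by (rule almost_below.below)
  next
    case (step v S)
    have "U1 \<subseteq> adjoin H S v" using subset_adjoin subspaceD(1)[OF step(5)] step(1,4) by blast
    then show ?case
      using almost_below.step[OF step(1) step(3)[OF _ subspace_adjoin[OF step(5,1)]]] by simp
  qed
next
  case (step v S)
  have "almost_below H U2 (adjoin H S v)"
    using subset_adjoin subspaceD(1)[OF step(5)] step(1,4) almost_below_mono_right by metis
  then show ?case
    using almost_below.step[OF step(1) step(3)[OF _ subspace_adjoin[OF step(5,1)]]] by simp
qed

end

lemma almost_below_image:
  assumes "T \<in> linear_ops H K" "complex_prehilbert_space H"
    and "almost_below H U S" "S \<subseteq> carrier H"
  shows "almost_below K (T ` U) (T ` S)"
  using assms(3,4)
proof (induct rule: almost_below.induct)
  case (below S) then show ?case by (blast intro: almost_below.below)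
next
  case (step v S)
  interpret H: complex_prehilbert_space H by fact
  note D = linear_opsD[OF assms(1)]
  have "T ` adjoin H S v = adjoin K (T ` S) (T v)"
    using step(1,4) by (force simp: adjoin_def D subset_iff)
  then show ?case using step D(1) H.adjoin_subset by (metis almost_below.step)
qed

text \<open>When a vector \<open>v\<close> is adjoined to \<open>S\<close>, the preimage of \<open>S\<close> grows by at most one dimension: if
  some \<open>w\<close> enters it, with \<open>T w = s + c v\<close> and \<open>c \<noteq> 0\<close>, then a multiple of \<open>w\<close> brings every other
  new vector back to the preimage of \<open>S\<close>. The subspace \<open>Z\<close> serves to impose further linear
  conditions at the same time.\<close>

lemma almost_below_vimage:
  assumes "T \<in> linear_ops H K" "complex_prehilbert_space H" "complex_prehilbert_space K"
    and Z: "subspace_of H Z"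
    and "almost_below K U S" "subspace_of K S"
  shows "almost_below H {x \<in> Z. T x \<in> U} {x \<in> Z. T x \<in> S}"
  using assms(5,6)
proof (induct rule: almost_below.induct)
  case (below S) then show ?case by (blast intro: almost_below.below)
next
  case (step v S)
  interpret H: complex_prehilbert_space H by fact
  interpret K: complex_prehilbert_space K by fact
  note D = linear_opsD[OF assms(1)] and S = K.subspaceD[OF step(4)] and Z = H.subspaceD[OF Z]
  have IH: "almost_below H {x \<in> Z. T x \<in> U} {x \<in> Z. T x \<in> adjoin K S v}"
    by (rule step(3)[OF K.subspace_adjoin[OF step(4,1)]])
  show ?case
  proof (cases "{x \<in> Z. T x \<in> adjoin K S v} \<subseteq> {x \<in> Z. T x \<in> S}")
    case True
    with IH show ?thesis by (rule almost_below_mono_right)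
  next
    case False
    then obtain w where w0: "w \<in> Z" "T w \<notin> S" "T w \<in> adjoin K S v" by auto
    from w0(3) obtain s c where sc: "s \<in> S" "T w = s \<oplus>\<^bsub>K\<^esub> c \<odot>\<^bsub>K\<^esub> v"
      unfolding adjoin_def by auto
    note w = w0(1,2) sc
    have wc: "w \<in> carrier H" "s \<in> carrier K" using Z(2)[OF w(1)] S(2)[OF w(3)] .
    have "c \<noteq> 0" using w(2-4) step(1) wc(2) by auto
    have "x \<in> adjoin H {x \<in> Z. T x \<in> S} w" if x: "x \<in> Z" "T x \<in> adjoin K S v" for x
    proof -
      obtain t d where t: "t \<in> S" "T x = t \<oplus>\<^bsub>K\<^esub> d \<odot>\<^bsub>K\<^esub> v"
        using x(2) unfolding adjoin_def by auto
      define x' where "x' = x \<ominus>\<^bsub>H\<^esub> (d / c) \<odot>\<^bsub>H\<^esub> w"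
      have xc: "x \<in> carrier H" "t \<in> carrier K" using Z(2)[OF x(1)] S(2)[OF t(1)] .
      have x': "x' \<in> Z" unfolding x'_def using Z(5)[OF x(1) Z(6)[OF w(1)]] .
      have "T x' = T x \<ominus>\<^bsub>K\<^esub> (d / c) \<odot>\<^bsub>K\<^esub> T w"
        using xc wc by (simp add: x'_def linear_ops_diff[OF assms(1-3)] D)
      also have "\<dots> = t \<ominus>\<^bsub>K\<^esub> (d / c) \<odot>\<^bsub>K\<^esub> s"
      proof (rule K.cinner_ext)
        fix z assume z: "z \<in> carrier K"
        show "cinner K (T x \<ominus>\<^bsub>K\<^esub> (d / c) \<odot>\<^bsub>K\<^esub> T w) z = cinner K (t \<ominus>\<^bsub>K\<^esub> (d / c) \<odot>\<^bsub>K\<^esub> s) z"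
          unfolding t(2) w(4) using z xc wc step(1)
          by (simp add: K.cinner_left distrib_left \<open>c \<noteq> 0\<close>)
      qed (use t(2) w(4) xc wc step(1) in auto)
      also have "\<dots> \<in> S" using S(5)[OF t(1) S(6)[OF w(3)]] .
      finally have "T x' \<in> S" .
      moreover have "x = x' \<oplus>\<^bsub>H\<^esub> (d / c) \<odot>\<^bsub>H\<^esub> w"
        using xc wc by (intro H.cinner_ext) (auto simp: x'_def H.cinner_left)
      ultimately show ?thesis using x' unfolding adjoin_def mem_Collect_eq by blast
    qed
    then have "almost_below H {x \<in> Z. T x \<in> U} (adjoin H {x \<in> Z. T x \<in> S} w)"
      using almost_below_mono_right[OF IH] by blast
    with wc(1) show ?thesis by (rule almost_below.step)
  qed
qed

section \<open>Algebraic codimension\<close>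

definition independent_mod :: "'a hilbert \<Rightarrow> 'a set \<Rightarrow> 'a set \<Rightarrow> bool" where
  "independent_mod H S B \<longleftrightarrow> B \<subseteq> carrier H \<and>
     (\<forall>F c. finite F \<and> F \<subseteq> B \<and> (\<Oplus>\<^bsub>H\<^esub>b\<in>F. c b \<odot>\<^bsub>H\<^esub> b) \<in> S \<longrightarrow> (\<forall>b\<in>F. c b = 0))"

lemma independent_modD:
  "\<lbrakk>independent_mod H S B; finite F; F \<subseteq> B; (\<Oplus>\<^bsub>H\<^esub>b\<in>F. c b \<odot>\<^bsub>H\<^esub> b) \<in> S; b \<in> F\<rbrakk> \<Longrightarrow> c b = 0"
  unfolding independent_mod_def by blast

lemma independent_modI:
  assumes "B \<subseteq> carrier H"
    and "\<And>F c b. \<lbrakk>finite F; F \<subseteq> B; (\<Oplus>\<^bsub>H\<^esub>b\<in>F. c b \<odot>\<^bsub>H\<^esub> b) \<in> S; b \<in> F\<rbrakk> \<Longrightarrow> c b = 0"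
  shows "independent_mod H S B"
  unfolding independent_mod_def
proof (intro conjI allI impI ballI)
  fix F c b
  assume "finite F \<and> F \<subseteq> B \<and> (\<Oplus>\<^bsub>H\<^esub>b\<in>F. c b \<odot>\<^bsub>H\<^esub> b) \<in> S" "b \<in> F"
  then show "c b = 0" using assms(2)[of F c b] by simp
qed (rule assms(1))

lemma dependent_modE:
  assumes "\<not> independent_mod H S B" "B \<subseteq> carrier H"
  obtains F c b where "finite F" "F \<subseteq> B" "(\<Oplus>\<^bsub>H\<^esub>b\<in>F. c b \<odot>\<^bsub>H\<^esub> b) \<in> S" "b \<in> F" "c b \<noteq> 0"
proof (rule ccontr)
  assume n: "\<not> thesis"
  have "independent_mod H S B"
  proof (rule independent_modI[OF assms(2)])
    fix F c b
    assume "finite F" "F \<subseteq> B" "(\<Oplus>\<^bsub>H\<^esub>b\<in>F. c b \<odot>\<^bsub>H\<^esub> b) \<in> S" "b \<in> F"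
    then show "c b = 0" using that[of F c b] n by argo
  qed
  with assms(1) show False by simp
qed

context complex_prehilbert_space
begin

lemma lincomb_closed [simp, intro]: "F \<subseteq> carrier H \<Longrightarrow> (\<Oplus>b\<in>F. c b \<odot> b) \<in> carrier H"
  by (rule finsum_closed) auto

lemma cinner_lincomb_left:
  "finite F \<Longrightarrow> F \<subseteq> carrier H \<Longrightarrow> z \<in> carrier H \<Longrightarrow>
   cinner H (\<Oplus>b\<in>F. c b \<odot> b) z = (\<Sum>b\<in>F. c b * cinner H b z)"
  by (subst cinner_finsum_left) (auto simp: cinner_smult_left intro!: sum.cong)

text \<open>The exchange step. A nontrivial relation modulo the enlarged subspace involves some \<open>b0\<close> with
  a nonzero coefficient. A second relation, among the vectors other than \<open>b0\<close>, can be combined with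
  the first so that \<open>v\<close> cancels; the coefficient of \<open>b0\<close> in the combination then forces the second
  relation not to involve \<open>v\<close>.\<close>

lemma independent_mod_adjoin:
  assumes S: "subspace_of H S" and v: "v \<in> carrier H" and B: "independent_mod H S B"
  shows "\<exists>b. independent_mod H (adjoin H S v) (B - {b})"
proof (cases "independent_mod H (adjoin H S v) B")
  case True
  have "independent_mod H (adjoin H S v) (B - {b})" for b
  proof (rule independent_modI)
    show "B - {b} \<subseteq> carrier H" using True by (auto simp: independent_mod_def)
    fix F c b' assume "finite F" "F \<subseteq> B - {b}" "(\<Oplus>b\<in>F. c b \<odot> b) \<in> adjoin H S v" "b' \<in> F"
    then show "c b' = 0" using independent_modD[OF True, of F c b'] by blast
  qed
  then show ?thesis by (rule exI)
next
  case False
  have BH: "B \<subseteq> carrier H" using B by (auto simp: independent_mod_def)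
  from False BH obtain F c b0 where F0: "finite F" "F \<subseteq> B"
    and lc: "(\<Oplus>b\<in>F. c b \<odot> b) \<in> adjoin H S v" and F1: "b0 \<in> F" "c b0 \<noteq> 0"
    by (rule dependent_modE)
  note F = F0 F1
  from lc obtain s d where s: "s \<in> S" "(\<Oplus>b\<in>F. c b \<odot> b) = s \<oplus> d \<odot> v"
    unfolding adjoin_def by blast
  have "independent_mod H (adjoin H S v) (B - {b0})"
  proof (rule independent_modI)
    show "B - {b0} \<subseteq> carrier H" using BH by auto
    fix F' c' b
    assume A: "finite F'" "F' \<subseteq> B - {b0}" "(\<Oplus>b\<in>F'. c' b \<odot> b) \<in> adjoin H S v" "b \<in> F'"
    from A(3) obtain s' d' where s': "s' \<in> S" "(\<Oplus>b\<in>F'. c' b \<odot> b) = s' \<oplus> d' \<odot> v"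
      unfolding adjoin_def by blast
    have fin: "finite (F \<union> F')" and sub: "F \<union> F' \<subseteq> B" and b0: "b0 \<notin> F'" using A F by auto
    \<comment> \<open>the combination of the two relations in which \<open>v\<close> cancels\<close>
    define e where "e b = (if b \<in> F' then d * c' b else 0) - (if b \<in> F then d' * c b else 0)" for b
    note sc = subspaceD(2)[OF S s(1)] subspaceD(2)[OF S s'(1)]
    have "(\<Oplus>b\<in>F\<union>F'. e b \<odot> b) = d \<odot> s' \<ominus> d' \<odot> s"
    proof (rule cinner_ext)
      fix z assume z: "z \<in> carrier H"
      have 1: "(\<Sum>b\<in>F. c b * cinner H b z) = cinner H s z + d * cinner H v z"
        using arg_cong[OF s(2), of "\<lambda>u. cinner H u z"] z v sc F BH
        by (simp add: cinner_lincomb_left cinner_left subset_iff)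
      have 2: "(\<Sum>b\<in>F'. c' b * cinner H b z) = cinner H s' z + d' * cinner H v z"
        using arg_cong[OF s'(2), of "\<lambda>u. cinner H u z"] z v sc A BH
        by (subst (asm) cinner_lincomb_left) (auto simp: cinner_left)
      have "cinner H (\<Oplus>b\<in>F\<union>F'. e b \<odot> b) z = (\<Sum>b\<in>F\<union>F'. e b * cinner H b z)"
        using z sub fin BH by (intro cinner_lincomb_left) auto
      also have "\<dots> = (\<Sum>b\<in>F\<union>F'. (if b \<in> F' then d * (c' b * cinner H b z) else 0))
                   - (\<Sum>b\<in>F\<union>F'. (if b \<in> F then d' * (c b * cinner H b z) else 0))"
        by (subst sum_subtractf[symmetric]) (auto simp: e_def algebra_simps intro!: sum.cong)
      also have "(\<Sum>b\<in>F\<union>F'. (if b \<in> F' then d * (c' b * cinner H b z) else 0))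
          = d * (\<Sum>b\<in>F'. c' b * cinner H b z)"
        using fin by (simp add: sum.If_cases sum_distrib_left Int_absorb1)
      also have "(\<Sum>b\<in>F\<union>F'. (if b \<in> F then d' * (c b * cinner H b z) else 0))
          = d' * (\<Sum>b\<in>F. c b * cinner H b z)"
        using fin by (simp add: sum.If_cases sum_distrib_left Int_absorb1)
      finally show "cinner H (\<Oplus>b\<in>F\<union>F'. e b \<odot> b) z = cinner H (d \<odot> s' \<ominus> d' \<odot> s) z"
        unfolding 1 2 using z sc by (simp add: cinner_left algebra_simps)
    qed (use sub BH sc in auto)
    also have "\<dots> \<in> S" using subspaceD[OF S] s s' by auto
    finally have "e b0 = 0"
      using independent_modD[OF B fin sub] F(3) by blast
    then have "d' = 0" using F b0 by (simp add: e_def)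
    then have "(\<Oplus>b\<in>F'. c' b \<odot> b) \<in> S" using s' sc v by simp
    then show "c' b = 0" using independent_modD[OF B, of F' c'] A by blast
  qed
  then show ?thesis by blast
qed

lemma independent_mod_finite:
  assumes "almost_below H (carrier H) S" "subspace_of H S" "independent_mod H S B"
  shows "finite B"
  using assms
proof (induct arbitrary: B rule: almost_below.induct)
  case (below S)
  have "False" if b: "b \<in> B" for b
  proof -
    have "b \<in> carrier H" using b below(3) by (auto simp: independent_mod_def)
    then have "(\<Oplus>x\<in>{b}. 1 \<odot> x) \<in> S" using below(1) by auto
    then show False using independent_modD[OF below(3), of "{b}" "\<lambda>_. 1" b] b by simp
  qed
  then have "B = {}" by blast
  then show ?case by simp
next
  case (step v S)
  obtain b where "independent_mod H (adjoin H S v) (B - {b})"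
    using independent_mod_adjoin step by blast
  then have "finite (B - {b})" using step subspace_adjoin by blast
  then show ?case by simp
qed

text \<open>Zorn's lemma is required because the quotient dimension picks an arbitrary basis, whose
  existence has to be known also when it is infinite.\<close>

lemma quotient_basis_exists:
  assumes S: "subspace_of H S"
  shows "\<exists>B. quotient_basis H S B"
proof -
  have "\<exists>M\<in>Collect (independent_mod H S). \<forall>Y\<in>Collect (independent_mod H S). M \<subseteq> Y \<longrightarrow> Y = M"
  proof (rule Zorn_Lemma, rule ballI)
    fix C assume C: "C \<in> chains (Collect (independent_mod H S))"
    have CI: "independent_mod H S B" if "B \<in> C" for B
      using C that by (auto simp: chains_def)
    have "independent_mod H S (\<Union>C)"
    proof (rule independent_modI)
      show "\<Union>C \<subseteq> carrier H" using CI by (auto simp: independent_mod_def)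
      fix F c b assume F: "finite F" "F \<subseteq> \<Union>C" "(\<Oplus>b\<in>F. c b \<odot> b) \<in> S" "b \<in> F"
      show "c b = 0"
      proof (cases "C = {}")
        case False
        then obtain B where "B \<in> C" "F \<subseteq> B"
          using finite_subset_Union_chain[of F C "Collect (independent_mod H S)"] F(1,2) C
          by (auto simp: chains_alt_def)
        then show ?thesis using independent_modD[OF CI, of B F c b] F by blast
      qed (use F in auto)
    qed
    then show "\<Union>C \<in> Collect (independent_mod H S)" by simp
  qed
  then obtain M where M: "independent_mod H S M"
    and max: "\<And>Y. independent_mod H S Y \<Longrightarrow> M \<subseteq> Y \<Longrightarrow> Y = M" by blast
  have MH: "M \<subseteq> carrier H" using M by (auto simp: independent_mod_def)
  have "\<exists>F c. finite F \<and> F \<subseteq> M \<and> x \<ominus> (\<Oplus>b\<in>F. c b \<odot> b) \<in> S" if x: "x \<in> carrier H" for x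
  proof (cases "x \<in> M")
    case True
    have "x \<ominus> (\<Oplus>b\<in>{x}. 1 \<odot> b) = \<zero>" using x by (simp add: minus_eq r_neg)
    then show ?thesis using True subspaceD(3)[OF S]
      by (intro exI[of _ "{x}"] exI[of _ "\<lambda>_. 1"]) auto
  next
    case False
    then have "\<not> independent_mod H S (insert x M)" using max[of "insert x M"] by auto
    then obtain F c b0 where F: "finite F" "F \<subseteq> insert x M" "(\<Oplus>b\<in>F. c b \<odot> b) \<in> S"
      and nz: "b0 \<in> F" "c b0 \<noteq> 0"
      by (rule dependent_modE) (use x MH in auto)
    have FH: "F \<subseteq> carrier H" "F - {x} \<subseteq> carrier H" using F x MH by auto
    have Mx: "F - {x} \<subseteq> M" using F by auto
    have xF: "x \<in> F" using independent_modD[OF M F(1) _ F(3)] F(2) nz by blast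
    have split: "(\<Oplus>b\<in>F. c b \<odot> b) = c x \<odot> x \<oplus> (\<Oplus>b\<in>F - {x}. c b \<odot> b)"
      using finsum_insert[of "F - {x}" x "\<lambda>b. c b \<odot> b"] F xF x FH
      by (simp add: insert_absorb Pi_def subset_iff)
    have cx: "c x \<noteq> 0"
    proof
      assume c0: "c x = 0"
      then have "(\<Oplus>b\<in>F - {x}. c b \<odot> b) \<in> S" using F(3) split x FH by simp
      then have "c b0 = 0 \<or> b0 = x" using independent_modD[OF M _ Mx, of c b0] F(1) nz by blast
      then show False using nz c0 by blast
    qed
    have "x \<ominus> (\<Oplus>b\<in>F - {x}. (- c b / c x) \<odot> b) = (1 / c x) \<odot> (\<Oplus>b\<in>F. c b \<odot> b)"
      unfolding split
    proof (rule cinner_ext)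
      fix z assume z: "z \<in> carrier H"
      define P where "P = (\<Sum>b\<in>F - {x}. c b * cinner H b z)"
      have "(\<Sum>b\<in>F - {x}. (- c b / c x) * cinner H b z) = - (P / c x)"
        unfolding P_def by (simp add: sum_divide_distrib sum_negf)
      moreover have "(1 / c x) * (c x * cinner H x z + P) = cinner H x z + P / c x"
        using cx by (simp add: distrib_left)
      ultimately show "cinner H (x \<ominus> (\<Oplus>b\<in>F - {x}. (- c b / c x) \<odot> b)) z =
          cinner H ((1 / c x) \<odot> (c x \<odot> x \<oplus> (\<Oplus>b\<in>F - {x}. c b \<odot> b))) z"
        using z x FH F(1) cx P_def
        by (simp add: cinner_left cinner_lincomb_left del: times_divide_eq_left divide_minus_left mult_minus_left)
    qed (use x FH in auto)
    also have "\<dots> \<in> S" using F subspaceD[OF S] by auto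
    finally have "x \<ominus> (\<Oplus>b\<in>F - {x}. (- c b / c x) \<odot> b) \<in> S" .
    then show ?thesis using Mx F(1)
      by (intro exI[of _ "F - {x}"] exI[of _ "\<lambda>b. - c b / c x"] conjI) (assumption | simp)+
  qed
  then have "quotient_basis H S M"
    using M unfolding quotient_basis_def independent_mod_def by simp
  then show ?thesis ..
qed

lemma almost_below_finite_span:
  assumes "finite F" "F \<subseteq> carrier H" "subspace_of H S"
    and "\<And>x. x \<in> U \<Longrightarrow> \<exists>c. x \<ominus> (\<Oplus>b\<in>F. c b \<odot> b) \<in> S" and "U \<subseteq> carrier H"
  shows "almost_below H U S"
  using assms
proof (induct F arbitrary: S rule: finite_induct)
  case empty
  have "U \<subseteq> S"
  proof
    fix x assume "x \<in> U"
    then have "x \<ominus> \<zero> \<in> S" "x \<in> carrier H" using empty by auto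
    then show "x \<in> S" by (simp only: diff_zero)
  qed
  then show ?case by (rule almost_below.below)
next
  case (insert v F)
  have v: "v \<in> carrier H" and F: "F \<subseteq> carrier H" using insert by auto
  have "almost_below H U (adjoin H S v)"
  proof (rule insert(3)[OF F subspace_adjoin[OF insert(5) v] _ insert(7)])
    fix x assume x: "x \<in> U"
    then have xc: "x \<in> carrier H" using insert by auto
    obtain c where c: "x \<ominus> (\<Oplus>b\<in>insert v F. c b \<odot> b) \<in> S" using insert(6)[OF x] by blast
    have "(\<Oplus>b\<in>insert v F. c b \<odot> b) = c v \<odot> v \<oplus> (\<Oplus>b\<in>F. c b \<odot> b)"
      using insert(1,2) v F by (intro finsum_insert) auto
    then have "x \<ominus> (\<Oplus>b\<in>F. c b \<odot> b) = (x \<ominus> (\<Oplus>b\<in>insert v F. c b \<odot> b)) \<oplus> c v \<odot> v"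
      using xc v F by (intro cinner_ext) (auto simp: cinner_left)
    then show "\<exists>c. x \<ominus> (\<Oplus>b\<in>F. c b \<odot> b) \<in> adjoin H S v"
      using c unfolding adjoin_def by blast
  qed
  with v show ?case by (rule almost_below.step)
qed

lemma cfinite_quotient_dim_iff:
  assumes S: "subspace_of H S"
  shows "BNF_Cardinal_Arithmetic.cfinite (quotient_dim H S) \<longleftrightarrow> almost_below H (carrier H) S"
proof -
  define B where "B = (SOME B. quotient_basis H S B)"
  have B: "quotient_basis H S B" unfolding B_def using quotient_basis_exists[OF S] by (rule someI_ex)
  have "BNF_Cardinal_Arithmetic.cfinite (quotient_dim H S) \<longleftrightarrow> finite B"
    by (simp add: quotient_dim_def B_def[symmetric] BNF_Cardinal_Arithmetic.cfinite_def Field_card_of)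
  also have "\<dots> \<longleftrightarrow> almost_below H (carrier H) S"
  proof
    assume fin: "finite B"
    have BH: "B \<subseteq> carrier H" using B by (auto simp: quotient_basis_def)
    show "almost_below H (carrier H) S"
    proof (rule almost_below_finite_span[OF fin BH S])
      fix x assume x: "x \<in> carrier H"
      then obtain F c where F: "finite F" "F \<subseteq> B" "x \<ominus> (\<Oplus>b\<in>F. c b \<odot> b) \<in> S"
        using B unfolding quotient_basis_def by metis
      have "(\<Oplus>b\<in>B. (if b \<in> F then c b else 0) \<odot> b) = (\<Oplus>b\<in>F. c b \<odot> b)"
      proof (rule cinner_ext)
        fix z assume z: "z \<in> carrier H"
        have "(\<Sum>b\<in>B. (if b \<in> F then c b else 0) * cinner H b z) = (\<Sum>b\<in>F. c b * cinner H b z)"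
          using fin F(2) by (intro sum.mono_neutral_cong_right) auto
        then show "cinner H (\<Oplus>b\<in>B. (if b \<in> F then c b else 0) \<odot> b) z
            = cinner H (\<Oplus>b\<in>F. c b \<odot> b) z"
          using z fin F BH by (simp add: cinner_lincomb_left subset_iff)
      qed (use F BH in auto)
      then have "x \<ominus> (\<Oplus>b\<in>B. (if b \<in> F then c b else 0) \<odot> b) \<in> S" using F(3) by simp
      then show "\<exists>c. x \<ominus> (\<Oplus>b\<in>B. c b \<odot> b) \<in> S"
        by (intro exI[of _ "\<lambda>b. if b \<in> F then c b else 0"])
    qed simp
  next
    assume "almost_below H (carrier H) S"
    moreover have "independent_mod H S B"
      using B unfolding quotient_basis_def independent_mod_def by simp
    ultimately show "finite B" using independent_mod_finite S by metis
  qed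
  finally show ?thesis .
qed

end

section \<open>Norm, limits and orthonormal sets\<close>

definition hlim :: "'a hilbert \<Rightarrow> (nat \<Rightarrow> 'a) \<Rightarrow> 'a \<Rightarrow> bool" where
  "hlim H u l \<longleftrightarrow> (\<forall>k. u k \<in> carrier H) \<and> l \<in> carrier H \<and> (\<lambda>k. hnorm H (u k \<ominus>\<^bsub>H\<^esub> l)) \<longlonglongrightarrow> 0"

context complex_prehilbert_space
begin

lemma cinner_self: "x \<in> carrier H \<Longrightarrow> cinner H x x = complex_of_real ((hnorm H x)\<^sup>2)"
  using cinner_commute[of x x] cinner_ge_zero[of x]
  by (simp add: hnorm_def complex_eq_iff)

lemma hnorm_sq: "x \<in> carrier H \<Longrightarrow> (hnorm H x)\<^sup>2 = Re (cinner H x x)"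
  by (simp add: cinner_self)

lemma hnorm_nonneg [simp]: "x \<in> carrier H \<Longrightarrow> 0 \<le> hnorm H x"
  using cinner_ge_zero[of x] by (simp add: hnorm_def)

lemma hnorm_eq_zeroD: "x \<in> carrier H \<Longrightarrow> hnorm H x = 0 \<Longrightarrow> x = \<zero>"
  using cinner_self[of x] cinner_eq_zeroD[of x] by simp

lemma hnorm_zero [simp]: "hnorm H \<zero> = 0"
  by (simp add: hnorm_def)

lemma hnorm_smult: "x \<in> carrier H \<Longrightarrow> hnorm H (c \<odot> x) = cmod c * hnorm H x"
proof -
  assume x: "x \<in> carrier H"
  have "cinner H (c \<odot> x) (c \<odot> x) = complex_of_real ((cmod c)\<^sup>2) * cinner H x x"
    unfolding complex_norm_square using x by (simp add: cinner_left cinner_right)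
  also have "\<dots> = complex_of_real ((cmod c * hnorm H x)\<^sup>2)"
    using x by (simp add: cinner_self power_mult_distrib)
  finally have "(hnorm H (c \<odot> x))\<^sup>2 = (cmod c * hnorm H x)\<^sup>2"
    using x by (metis smult_in cinner_self of_real_eq_iff)
  then show ?thesis using x by (simp add: power2_eq_iff_nonneg)
qed

lemma hnorm_uminus: "x \<in> carrier H \<Longrightarrow> hnorm H (\<ominus> x) = hnorm H x"
proof -
  assume x: "x \<in> carrier H"
  have "\<ominus> x = (-1) \<odot> x" using x by (intro cinner_ext) (auto simp: cinner_left)
  then show ?thesis using hnorm_smult[OF x, of "-1"] by simp
qed

lemma hnorm_minus_commute:
  "x \<in> carrier H \<Longrightarrow> y \<in> carrier H \<Longrightarrow> hnorm H (x \<ominus> y) = hnorm H (y \<ominus> x)"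
proof -
  assume *: "x \<in> carrier H" "y \<in> carrier H"
  have "x \<ominus> y = \<ominus> (y \<ominus> x)" using * by (intro cinner_ext) (auto simp: cinner_left)
  then show ?thesis using * by (simp add: hnorm_uminus)
qed

lemma cauchy_schwarz:
  assumes x: "x \<in> carrier H" and y: "y \<in> carrier H"
  shows "cmod (cinner H x y) \<le> hnorm H x * hnorm H y"
proof (cases "y = \<zero>")
  case True
  then show ?thesis using x by (simp add: cinner_right)
next
  case False
  then have N: "hnorm H y > 0" using hnorm_nonneg[OF y] hnorm_eq_zeroD[OF y] by (cases "hnorm H y = 0") auto
  define a where "a = cinner H x y"
  define t where "t = a / of_real ((hnorm H y)\<^sup>2)"
  have "cinner H (x \<ominus> t \<odot> y) (x \<ominus> t \<odot> y)
      = cinner H x x - cnj t * a - t * cnj a + t * cnj t * cinner H y y"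
    using x y by (simp add: cinner_left cinner_right a_def cinner_commute[of y x] algebra_simps)
  also have "t * cnj t * cinner H y y = t * cnj a"
  proof -
    have "cnj t * complex_of_real ((hnorm H y)\<^sup>2) = cnj a"
      unfolding t_def complex_cnj_divide complex_cnj_complex_of_real using N by simp
    then show ?thesis using y by (simp only: cinner_self mult.assoc)
  qed
  also have "cinner H x x - cnj t * a - t * cnj a + t * cnj a = cinner H x x - cnj t * a"
    by simp
  also have "cnj t * a = complex_of_real ((cmod a)\<^sup>2 / (hnorm H y)\<^sup>2)"
    unfolding of_real_divide complex_norm_square by (simp add: t_def)
  also have "cinner H x x - complex_of_real ((cmod a)\<^sup>2 / (hnorm H y)\<^sup>2)
      = complex_of_real ((hnorm H x)\<^sup>2 - (cmod a)\<^sup>2 / (hnorm H y)\<^sup>2)"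
    using x by (simp add: cinner_self)
  finally have "0 \<le> (hnorm H x)\<^sup>2 - (cmod a)\<^sup>2 / (hnorm H y)\<^sup>2"
    using cinner_ge_zero[of "x \<ominus> t \<odot> y"] x y by simp
  then have "(cmod a)\<^sup>2 \<le> (hnorm H x * hnorm H y)\<^sup>2"
    using N by (simp add: pos_divide_le_eq power_mult_distrib)
  then show ?thesis unfolding a_def by (rule power2_le_imp_le) (use x y in simp)
qed

lemma hnorm_triangle:
  assumes x: "x \<in> carrier H" and y: "y \<in> carrier H"
  shows "hnorm H (x \<oplus> y) \<le> hnorm H x + hnorm H y"
proof (rule power2_le_imp_le)
  have 1: "Re (cinner H x y) \<le> hnorm H x * hnorm H y"
    using cauchy_schwarz[OF x y] complex_Re_le_cmod[of "cinner H x y"] by linarith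
  have 2: "Re (cinner H y x) = Re (cinner H x y)" using cinner_commute[OF x y] by simp
  have "cinner H (x \<oplus> y) (x \<oplus> y) = cinner H x x + cinner H x y + (cinner H y x + cinner H y y)"
    using x y by (simp add: cinner_add_left cinner_right(1))
  then have 3: "(hnorm H (x \<oplus> y))\<^sup>2 = (hnorm H x)\<^sup>2 + Re (cinner H x y) + (Re (cinner H y x) + (hnorm H y)\<^sup>2)"
    using x y by (simp add: hnorm_sq)
  have 4: "(hnorm H x + hnorm H y)\<^sup>2 = (hnorm H x)\<^sup>2 + (hnorm H y)\<^sup>2 + 2 * (hnorm H x * hnorm H y)"
    by (simp add: power2_sum)
  show "(hnorm H (x \<oplus> y))\<^sup>2 \<le> (hnorm H x + hnorm H y)\<^sup>2"
    using 1 2 3 4 by linarith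
qed (use x y in simp)

lemma hnorm_diff_triangle:
  assumes "x \<in> carrier H" "y \<in> carrier H" "z \<in> carrier H"
  shows "hnorm H (x \<ominus> z) \<le> hnorm H (x \<ominus> y) + hnorm H (y \<ominus> z)"
proof -
  have "x \<ominus> z = (x \<ominus> y) \<oplus> (y \<ominus> z)"
    using assms by (intro cinner_ext) (auto simp: cinner_left)
  then show ?thesis using hnorm_triangle[of "x \<ominus> y" "y \<ominus> z"] assms by simp
qed

lemma hnorm_diff_zeroD:
  assumes "x \<in> carrier H" "y \<in> carrier H" "hnorm H (x \<ominus> y) = 0" shows "x = y"
proof -
  have "x \<ominus> y = \<zero>" using hnorm_eq_zeroD assms by simp
  then have "cinner H (x \<ominus> y) z = 0" if "z \<in> carrier H" for z using that by simp
  then show ?thesis using assms by (intro cinner_ext) (auto simp: cinner_left)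
qed

lemma Metric_space_hdist: "Metric_space (carrier H) (hdist H)"
proof
  show "0 \<le> hdist H x y" for x y by (simp add: hdist_def)
  show "hdist H x y = hdist H y x" for x y by (simp add: hdist_def hnorm_minus_commute)
  show "(hdist H x y = 0) = (x = y)" if "x \<in> carrier H" "y \<in> carrier H" for x y
    using that hnorm_diff_zeroD[of x y] by (auto simp: hdist_def minus_eq r_neg)
  show "hdist H x z \<le> hdist H x y + hdist H y z"
    if "x \<in> carrier H" "y \<in> carrier H" "z \<in> carrier H" for x y z
    using that hnorm_diff_triangle by (simp add: hdist_def)
qed

lemma limitin_iff_hlim:
  assumes "\<And>k. u k \<in> carrier H"
  shows "limitin (Metric_space.mtopology (carrier H) (hdist H)) u l sequentially \<longleftrightarrow> hlim H u l"
proof -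
  interpret M: Metric_space "carrier H" "hdist H" by (rule Metric_space_hdist)
  show ?thesis
    unfolding M.limitin_metric_dist_null hlim_def using assms
    by (auto simp: hdist_def)
qed

lemma hlim_closed: "hclosed H S \<Longrightarrow> hlim H u l \<Longrightarrow> (\<And>k. u k \<in> S) \<Longrightarrow> l \<in> S"
proof -
  interpret M: Metric_space "carrier H" "hdist H" by (rule Metric_space_hdist)
  assume *: "hclosed H S" "hlim H u l" "\<And>k. u k \<in> S"
  then have "limitin M.mtopology u l sequentially" using limitin_iff_hlim[of u l] by (simp add: hlim_def)
  then show ?thesis using * M.metric_closedin_iff_sequentially_closed[of S]
    unfolding hclosed_def by blast
qed

lemma hclosedI:
  assumes "S \<subseteq> carrier H" "\<And>u l. (\<And>k. u k \<in> S) \<Longrightarrow> hlim H u l \<Longrightarrow> l \<in> S"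
  shows "hclosed H S"
proof -
  interpret M: Metric_space "carrier H" "hdist H" by (rule Metric_space_hdist)
  have "l \<in> S" if "range u \<subseteq> S" "limitin M.mtopology u l sequentially" for u l
  proof -
    have u: "u k \<in> S" for k using that(1) by auto
    then have "hlim H u l" using that(2) limitin_iff_hlim[of u l] assms(1) by auto
    then show ?thesis using assms(2)[OF u] by simp
  qed
  then show ?thesis unfolding hclosed_def M.metric_closedin_iff_sequentially_closed
    using assms(1) by blast
qed

lemma mcomplete_iff_Cauchy_hlim:
  "Metric_space.mcomplete (carrier H) (hdist H) \<longleftrightarrow>
   (\<forall>u. (\<forall>k. u k \<in> carrier H) \<and> (\<forall>e>0. \<exists>N. \<forall>m\<ge>N. \<forall>n\<ge>N. hnorm H (u m \<ominus> u n) < e) \<longrightarrow> (\<exists>l. hlim H u l))"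
proof -
  interpret M: Metric_space "carrier H" "hdist H" by (rule Metric_space_hdist)
  have C: "M.MCauchy u \<longleftrightarrow> (\<forall>k. u k \<in> carrier H) \<and>
      (\<forall>e>0. \<exists>N. \<forall>m\<ge>N. \<forall>n\<ge>N. hnorm H (u m \<ominus> u n) < e)" for u
  proof (cases "\<forall>k. u k \<in> carrier H")
    case True
    then have "range u \<subseteq> carrier H" by auto
    then show ?thesis unfolding M.MCauchy_def using True by (auto simp: hdist_def)
  next
    case False
    then show ?thesis unfolding M.MCauchy_def by auto
  qed
  have L: "(M.MCauchy u \<longrightarrow> (\<exists>l. limitin M.mtopology u l sequentially)) \<longleftrightarrow>
      (M.MCauchy u \<longrightarrow> (\<exists>l. hlim H u l))" for u
    using C[of u] limitin_iff_hlim[of u] by auto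
  show ?thesis unfolding M.mcomplete_def using C L by simp
qed

lemma hlim_cinner:
  assumes "hlim H u l" "z \<in> carrier H"
  shows "(\<lambda>k. cinner H (u k) z) \<longlonglongrightarrow> cinner H l z"
proof -
  have u: "u k \<in> carrier H" "l \<in> carrier H" for k using assms by (auto simp: hlim_def)
  have "(\<lambda>k. cinner H (u k) z - cinner H l z) \<longlonglongrightarrow> 0"
  proof (rule Lim_null_comparison)
    show "\<forall>\<^sub>F k in sequentially. norm (cinner H (u k) z - cinner H l z) \<le> hnorm H (u k \<ominus> l) * hnorm H z"
      using u assms(2) cauchy_schwarz by (auto simp flip: cinner_diff_left)
    show "(\<lambda>k. hnorm H (u k \<ominus> l) * hnorm H z) \<longlonglongrightarrow> 0"
      using assms by (auto simp: hlim_def intro: tendsto_mult_left_zero)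
  qed
  then show ?thesis by (rule LIM_zero_cancel)
qed

lemma subspace_orth_compl: "S \<subseteq> carrier H \<Longrightarrow> subspace_of H (orth_compl H S)"
  unfolding orth_compl_def by (rule subspaceI) (simp_all add: cinner_left subset_iff)

lemma hclosed_orth_compl: "S \<subseteq> carrier H \<Longrightarrow> hclosed H (orth_compl H S)"
proof (rule hclosedI)
  fix u l assume S: "S \<subseteq> carrier H" and *: "\<And>k. u k \<in> orth_compl H S" "hlim H u l"
  have "cinner H l z = 0" if "z \<in> S" for z
  proof -
    have "(\<lambda>k. cinner H (u k) z) \<longlonglongrightarrow> cinner H l z" using that S * by (intro hlim_cinner) auto
    moreover have "cinner H (u k) z = 0" for k using *(1) that by (auto simp: orth_compl_def)
    ultimately show ?thesis by (simp add: LIMSEQ_const_iff)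
  qed
  then show "l \<in> orth_compl H S" using * by (auto simp: orth_compl_def hlim_def)
qed (auto simp: orth_compl_def)

lemma cinner_lincomb_orthonormal:
  assumes "orthonormal H B" "finite F" "F \<subseteq> B" "x \<in> B"
  shows "cinner H (\<Oplus>b\<in>F. c b \<odot> b) x = (if x \<in> F then c x else 0)"
proof -
  have BH: "B \<subseteq> carrier H" using assms by (auto simp: orthonormal_def)
  have "cinner H (\<Oplus>b\<in>F. c b \<odot> b) x = (\<Sum>b\<in>F. c b * cinner H b x)"
    using assms BH by (intro cinner_lincomb_left) auto
  also have "\<dots> = (\<Sum>b\<in>F. if b = x then c b else 0)"
    using assms unfolding orthonormal_def by (intro sum.cong) auto
  finally show ?thesis using assms(2) by simp
qed

lemma hnorm_lincomb_orthonormal: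
  assumes "orthonormal H B" "finite F" "F \<subseteq> B"
  shows "(hnorm H (\<Oplus>b\<in>F. c b \<odot> b))\<^sup>2 = (\<Sum>b\<in>F. (cmod (c b))\<^sup>2)"
proof -
  have FH: "F \<subseteq> carrier H" using assms by (auto simp: orthonormal_def)
  let ?p = "\<Oplus>b\<in>F. c b \<odot> b"
  have p: "?p \<in> carrier H" using FH by simp
  have "cinner H b ?p = cnj (c b)" if b: "b \<in> F" for b
  proof -
    have "b \<in> B" "b \<in> carrier H" using b assms(3) FH by auto
    then show ?thesis
      using cinner_lincomb_orthonormal[OF assms, of b c] cinner_commute[of b ?p] b p by simp
  qed
  then have "cinner H ?p ?p = (\<Sum>b\<in>F. c b * cnj (c b))"
    using cinner_lincomb_left[OF assms(2) FH p, of c] by simp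
  also have "\<dots> = complex_of_real (\<Sum>b\<in>F. (cmod (c b))\<^sup>2)"
    by (simp only: complex_norm_square of_real_sum)
  finally show ?thesis using p by (simp add: hnorm_sq)
qed

text \<open>The squared distance of \<open>x\<close> to its projection onto the span of \<open>F\<close> is the difference of the
  two sides.\<close>

lemma bessel:
  assumes "orthonormal H B" "finite F" "F \<subseteq> B" "x \<in> carrier H"
  shows "(\<Sum>b\<in>F. (cmod (cinner H x b))\<^sup>2) \<le> (hnorm H x)\<^sup>2"
proof -
  have FH: "F \<subseteq> carrier H" using assms by (auto simp: orthonormal_def)
  let ?p = "\<Oplus>b\<in>F. cinner H x b \<odot> b"
  have p: "?p \<in> carrier H" using FH by simp
  have "cinner H ?p x = (\<Sum>b\<in>F. cinner H x b * cinner H b x)"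
    using assms FH by (intro cinner_lincomb_left) auto
  also have "\<dots> = (\<Sum>b\<in>F. cinner H x b * cnj (cinner H x b))"
    using FH assms(4) by (intro sum.cong) (auto simp: cinner_commute[of _ x])
  also have "\<dots> = complex_of_real (\<Sum>b\<in>F. (cmod (cinner H x b))\<^sup>2)"
    by (simp only: complex_norm_square of_real_sum)
  finally have px: "cinner H ?p x = complex_of_real (\<Sum>b\<in>F. (cmod (cinner H x b))\<^sup>2)" .
  then have xp: "cinner H x ?p = complex_of_real (\<Sum>b\<in>F. (cmod (cinner H x b))\<^sup>2)"
    using cinner_commute[OF assms(4) p] by simp
  have pp: "Re (cinner H ?p ?p) = (\<Sum>b\<in>F. (cmod (cinner H x b))\<^sup>2)"
    using hnorm_lincomb_orthonormal[OF assms(1-3), of "cinner H x"] p by (simp add: hnorm_sq)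
  have "0 \<le> Re (cinner H (x \<ominus> ?p) (x \<ominus> ?p))" using assms(4) p by (intro cinner_ge_zero) auto
  also have "\<dots> = (hnorm H x)\<^sup>2 - (\<Sum>b\<in>F. (cmod (cinner H x b))\<^sup>2)"
    using assms(4) p px xp pp by (simp add: cinner_left cinner_right hnorm_sq)
  finally show ?thesis by simp
qed

lemma bessel_summable:
  assumes "orthonormal H B" "x \<in> carrier H"
  shows "(\<lambda>b. (cmod (cinner H x b))\<^sup>2) summable_on B"
    and "infsum (\<lambda>b. (cmod (cinner H x b))\<^sup>2) B \<le> (hnorm H x)\<^sup>2"
proof -
  show s: "(\<lambda>b. (cmod (cinner H x b))\<^sup>2) summable_on B"
    using bessel[OF assms(1) _ _ assms(2)]
    by (intro nonneg_bdd_above_summable_on) (auto intro!: bdd_aboveI2)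
  show "infsum (\<lambda>b. (cmod (cinner H x b))\<^sup>2) B \<le> (hnorm H x)\<^sup>2"
    using s bessel[OF assms(1) _ _ assms(2)] by (intro infsum_le_finite_sums) auto
qed

lemma orthonormal_basis_exists: "\<exists>B. orthonormal_basis H S B"
proof -
  let ?A = "{B. B \<subseteq> S \<and> orthonormal H B}"
  have "\<exists>M\<in>?A. \<forall>Y\<in>?A. M \<subseteq> Y \<longrightarrow> Y = M"
  proof (rule subset_Zorn')
    fix C assume C: "subset.chain ?A C"
    have "orthonormal H (\<Union>C)"
      unfolding orthonormal_def
    proof (intro conjI ballI)
      show "\<Union>C \<subseteq> carrier H" using C by (auto simp: subset_chain_def orthonormal_def)
      fix x y assume "x \<in> \<Union>C" "y \<in> \<Union>C"
      then obtain B B' where B: "B \<in> C" "x \<in> B" "B' \<in> C" "y \<in> B'" by blast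
      then have "B \<subseteq> B' \<or> B' \<subseteq> B" using C by (auto simp: subset_chain_def)
      then obtain B where "B \<in> C" "x \<in> B" "y \<in> B" using B by blast
      then show "cinner H x y = (if x = y then 1 else 0)"
        using C by (auto simp: subset_chain_def orthonormal_def)
    qed
    then show "\<Union>C \<in> ?A" using C by (auto simp: subset_chain_def)
  qed
  then obtain M where "M \<in> ?A" "\<And>Y. Y \<in> ?A \<Longrightarrow> M \<subseteq> Y \<Longrightarrow> Y = M" by metis
  then have "orthonormal_basis H S M" unfolding orthonormal_basis_def by auto
  then show ?thesis ..
qed

text \<open>Otherwise the normalised vector would enlarge the basis.\<close>

lemma orthonormal_basis_total:
  assumes B: "orthonormal_basis H S B" and S: "subspace_of H S"
    and x: "x \<in> S" "\<And>b. b \<in> B \<Longrightarrow> cinner H x b = 0"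
  shows "x = \<zero>"
proof (rule ccontr)
  assume nz: "x \<noteq> \<zero>"
  have xH: "x \<in> carrier H" using S x subspaceD by blast
  have BH: "B \<subseteq> carrier H" and on: "\<And>b b'. b \<in> B \<Longrightarrow> b' \<in> B \<Longrightarrow> cinner H b b' = (if b = b' then 1 else 0)"
    and max: "\<And>B'. B \<subseteq> B' \<Longrightarrow> B' \<subseteq> S \<Longrightarrow> orthonormal H B' \<Longrightarrow> B' = B" and BS: "B \<subseteq> S"
    using B unfolding orthonormal_basis_def orthonormal_def by auto
  have N: "hnorm H x \<noteq> 0" using nz hnorm_eq_zeroD xH by blast
  define u where "u = complex_of_real (1 / hnorm H x) \<odot> x"
  have u: "u \<in> carrier H" "u \<in> S" using xH x(1) subspaceD(6)[OF S] by (auto simp: u_def)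
  have "hnorm H u = 1" using N xH unfolding u_def by (simp add: hnorm_smult norm_divide)
  then have uu: "cinner H u u = 1" using cinner_self[OF u(1)] by simp
  have ub: "cinner H u b = 0" "cinner H b u = 0" if "b \<in> B" for b
  proof -
    show "cinner H u b = 0" using that x BH xH by (auto simp: u_def cinner_left)
    then show "cinner H b u = 0" using cinner_commute[of b u] that BH u by auto
  qed
  have uB: "u \<notin> B" using ub(1)[of u] uu by auto
  have "orthonormal H (insert u B)"
    unfolding orthonormal_def
  proof (intro conjI ballI)
    show "insert u B \<subseteq> carrier H" using u BH by simp
    fix y z assume "y \<in> insert u B" "z \<in> insert u B"
    then consider "y = u" "z = u" | "y = u" "z \<in> B" | "y \<in> B" "z = u" | "y \<in> B" "z \<in> B" by blast
    then show "cinner H y z = (if y = z then 1 else 0)"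
      by cases (use uu ub on uB in auto)
  qed
  then have "insert u B = B" using max[of "insert u B"] u BS by auto
  then show False using uB by blast
qed

end

section \<open>The Riesz-Fischer theorem and orthogonal projections\<close>

context complex_hilbert_space
begin

lemma Cauchy_hlim:
  assumes "\<And>k. u k \<in> carrier H" "\<And>e. e > 0 \<Longrightarrow> \<exists>N. \<forall>m\<ge>N. \<forall>n\<ge>N. hnorm H (u m \<ominus> u n) < e"
  shows "\<exists>l. hlim H u l"
  using complete assms unfolding mcomplete_iff_Cauchy_hlim by blast

text \<open>The index set may be uncountable, so the series is replaced by the sums over finite sets
  \<open>F k\<close> whose total weight misses the supremum by less than \<open>1/(k+1)\<close>. The squared distance of two
  such sums is the weight of the symmetric difference of the index sets, which makes them a Cauchy
  sequence. That the limit lies in every closed subspace containing \<open>B\<close> replaces any mention of the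
  closed span.\<close>

lemma riesz_fischer:
  assumes B: "orthonormal H B" and a: "(\<lambda>b. (cmod (a b))\<^sup>2) summable_on B"
  obtains y where "y \<in> carrier H" "\<And>b. b \<in> B \<Longrightarrow> cinner H y b = a b"
    "\<And>S. hclosed H S \<Longrightarrow> subspace_of H S \<Longrightarrow> B \<subseteq> S \<Longrightarrow> y \<in> S"
    "(hnorm H y)\<^sup>2 \<le> infsum (\<lambda>b. (cmod (a b))\<^sup>2) B"
proof -
  define w where "w b = (cmod (a b))\<^sup>2" for b
  define I where "I = infsum w B"
  have w0: "w b \<ge> 0" for b by (simp add: w_def)
  have ws: "w summable_on B" using a unfolding w_def .
  have fin_le: "sum w F \<le> I" if "finite F" "F \<subseteq> B" for F
    unfolding I_def using ws that w0 by (intro finite_sum_le_infsum) auto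
  have BH: "B \<subseteq> carrier H" using B by (auto simp: orthonormal_def)
  have "\<exists>F. finite F \<and> F \<subseteq> B \<and> I - 1 / real (Suc k) < sum w F" for k
  proof -
    have "I - 1 / real (Suc k) < I" by simp
    also have "I = (SUP F\<in>{F. finite F \<and> F \<subseteq> B}. sum w F)"
      unfolding I_def using ws w0 by (intro infsum_nonneg_is_SUPREMUM_real) auto
    finally obtain F where "F \<in> {F. finite F \<and> F \<subseteq> B}" "I - 1 / real (Suc k) < sum w F"
      using fin_le by (subst (asm) less_cSUP_iff) (auto intro!: bdd_aboveI2)
    then show ?thesis by auto
  qed
  then obtain F where F: "\<And>k. finite (F k)" "\<And>k. F k \<subseteq> B" "\<And>k. I - 1 / real (Suc k) < sum w (F k)"
    by metis
  define s where "s k = (\<Oplus>b\<in>F k. a b \<odot> b)" for k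
  have FH: "F k \<subseteq> carrier H" for k using F BH by blast
  have sH: "s k \<in> carrier H" for k using FH by (simp add: s_def)
  have diff: "(hnorm H (s m \<ominus> s n))\<^sup>2 \<le> 1 / real (Suc m) + 1 / real (Suc n)" for m n
  proof -
    define e where "e b = (if b \<in> F m then a b else 0) - (if b \<in> F n then a b else 0)" for b
    have fin: "finite (F m \<union> F n)" and sub: "F m \<union> F n \<subseteq> B" using F by auto
    have "s m \<ominus> s n = (\<Oplus>b\<in>F m \<union> F n. e b \<odot> b)"
    proof (rule cinner_ext)
      fix z assume z: "z \<in> carrier H"
      have "(\<Sum>b\<in>F m \<union> F n. e b * cinner H b z)
          = (\<Sum>b\<in>F m \<union> F n. if b \<in> F m then a b * cinner H b z else 0)
          - (\<Sum>b\<in>F m \<union> F n. if b \<in> F n then a b * cinner H b z else 0)"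
        by (subst sum_subtractf[symmetric]) (auto simp: e_def intro!: sum.cong)
      also have "(\<Sum>b\<in>F m \<union> F n. if b \<in> F m then a b * cinner H b z else 0) = (\<Sum>b\<in>F m. a b * cinner H b z)"
        using fin by (intro sum.mono_neutral_cong_right) auto
      also have "(\<Sum>b\<in>F m \<union> F n. if b \<in> F n then a b * cinner H b z else 0) = (\<Sum>b\<in>F n. a b * cinner H b z)"
        using fin by (intro sum.mono_neutral_cong_right) auto
      finally show "cinner H (s m \<ominus> s n) z = cinner H (\<Oplus>b\<in>F m \<union> F n. e b \<odot> b) z"
        using z sH F FH sub BH fin unfolding s_def
        by (simp add: cinner_diff_left cinner_lincomb_left)
    qed (use sH FH in auto)
    then have "(hnorm H (s m \<ominus> s n))\<^sup>2 = (\<Sum>b\<in>F m \<union> F n. (cmod (e b))\<^sup>2)"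
      using hnorm_lincomb_orthonormal[OF B fin sub] by simp
    \<comment> \<open>written so that only sums over \<open>F m\<close>, \<open>F n\<close> and their union appear\<close>
    also have "\<dots> = (\<Sum>b\<in>F m \<union> F n. 2 * w b - (if b \<in> F m then w b else 0) - (if b \<in> F n then w b else 0))"
      by (intro sum.cong) (auto simp: e_def w_def)
    also have "\<dots> = 2 * sum w (F m \<union> F n) - (\<Sum>b\<in>F m \<union> F n. if b \<in> F m then w b else 0)
        - (\<Sum>b\<in>F m \<union> F n. if b \<in> F n then w b else 0)"
      by (simp add: sum_subtractf sum_distrib_left)
    also have "(\<Sum>b\<in>F m \<union> F n. if b \<in> F m then w b else 0) = sum w (F m)"
      using fin by (intro sum.mono_neutral_cong_right) auto
    also have "(\<Sum>b\<in>F m \<union> F n. if b \<in> F n then w b else 0) = sum w (F n)"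
      using fin by (intro sum.mono_neutral_cong_right) auto
    finally show ?thesis using fin_le[OF fin sub] F(3)[of m] F(3)[of n] by linarith
  qed
  have "\<exists>N. \<forall>m\<ge>N. \<forall>n\<ge>N. hnorm H (s m \<ominus> s n) < e" if e: "e > 0" for e
  proof -
    obtain N where N: "1 / real (Suc N) < e\<^sup>2 / 2"
      using e nat_approx_posE[of "e\<^sup>2 / 2"] by auto
    have "hnorm H (s m \<ominus> s n) < e" if "m \<ge> N" "n \<ge> N" for m n
    proof (rule power2_less_imp_less)
      have "1 / real (Suc m) \<le> 1 / real (Suc N)" "1 / real (Suc n) \<le> 1 / real (Suc N)"
        using that by (auto intro!: divide_left_mono)
      then show "(hnorm H (s m \<ominus> s n))\<^sup>2 < e\<^sup>2" using diff[of m n] N by linarith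
    qed (use e in simp)
    then show ?thesis by blast
  qed
  then obtain y where y: "hlim H s y" using Cauchy_hlim[of s] sH by blast
  have yH: "y \<in> carrier H" using y by (simp add: hlim_def)
  show thesis
  proof
    show "y \<in> carrier H" by (rule yH)
  next
    fix b assume b: "b \<in> B"
    have "(\<lambda>k. cinner H (s k) b - a b) \<longlonglongrightarrow> 0"
    proof (rule Lim_null_comparison)
      have "cmod (cinner H (s k) b - a b) \<le> sqrt (1 / real (Suc k))" for k
      proof (cases "b \<in> F k")
        case True
        then show ?thesis using cinner_lincomb_orthonormal[OF B F(1)[of k] F(2)[of k] b, of a] by (simp add: s_def)
      next
        case False
        have "w b + sum w (F k) \<le> I"
          using fin_le[of "insert b (F k)"] F b False by simp
        then have "(cmod (a b))\<^sup>2 \<le> 1 / real (Suc k)" using F(3)[of k] unfolding w_def by linarith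
        then have "cmod (a b) \<le> sqrt (1 / real (Suc k))" by (rule real_le_rsqrt)
        then show ?thesis using cinner_lincomb_orthonormal[OF B F(1)[of k] F(2)[of k] b, of a] False by (simp add: s_def)
      qed
      then show "\<forall>\<^sub>F k in sequentially. norm (cinner H (s k) b - a b) \<le> sqrt (1 / real (Suc k))"
        by simp
      show "(\<lambda>k. sqrt (1 / real (Suc k))) \<longlonglongrightarrow> 0"
        using tendsto_real_sqrt[OF lim_1_over_n[THEN LIMSEQ_Suc]] by simp
    qed
    then have "(\<lambda>k. cinner H (s k) b) \<longlonglongrightarrow> a b" by (rule LIM_zero_cancel)
    moreover have "(\<lambda>k. cinner H (s k) b) \<longlonglongrightarrow> cinner H y b" using y b BH by (intro hlim_cinner) auto
    ultimately show "cinner H y b = a b" using LIMSEQ_unique by blast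
  next
    fix S assume S: "hclosed H S" "subspace_of H S" "B \<subseteq> S"
    have "s k \<in> S" for k
      unfolding s_def
    proof (rule subspace_finsum[OF S(2) F(1)], rule funcsetI)
      fix b assume "b \<in> F k"
      then have "b \<in> S" using F(2) S(3) by blast
      then show "a b \<odot> b \<in> S" by (rule subspaceD(6)[OF S(2)])
    qed
    then show "y \<in> S" using hlim_closed[OF S(1) y] by blast
  next
    have "hnorm H y \<le> sqrt I + hnorm H (s k \<ominus> y)" for k
    proof -
      have "(hnorm H (s k))\<^sup>2 \<le> I"
        using hnorm_lincomb_orthonormal[OF B F(1)[of k] F(2)[of k], of a] fin_le[OF F(1,2)] unfolding s_def w_def by simp
      then have "hnorm H (s k) \<le> sqrt I" by (rule real_le_rsqrt)
      moreover have "hnorm H (y \<ominus> \<zero>) \<le> hnorm H (y \<ominus> s k) + hnorm H (s k \<ominus> \<zero>)"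
        using yH sH by (intro hnorm_diff_triangle) auto
      ultimately show ?thesis using yH sH hnorm_minus_commute[of y "s k"] diff_zero by simp
    qed
    note le = this
    have "(\<lambda>k. sqrt I + hnorm H (s k \<ominus> y)) \<longlonglongrightarrow> sqrt I + 0"
      using y by (intro tendsto_intros) (simp add: hlim_def)
    then have "(\<lambda>k. sqrt I + hnorm H (s k \<ominus> y)) \<longlonglongrightarrow> sqrt I" by simp
    then have "hnorm H y \<le> sqrt I"
      by (rule LIMSEQ_le_const) (intro exI[of _ 0] allI impI le)
    then have "(hnorm H y)\<^sup>2 \<le> (sqrt I)\<^sup>2" by (rule power_mono) (use yH in simp)
    moreover have "I \<ge> 0" unfolding I_def using w0 by (rule infsum_nonneg)
    ultimately have "(hnorm H y)\<^sup>2 \<le> I" by simp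
    then show "(hnorm H y)\<^sup>2 \<le> infsum (\<lambda>b. (cmod (a b))\<^sup>2) B" unfolding I_def w_def .
  qed
qed

text \<open>Every \<open>x \<in> S\<close> is the Riesz-Fischer sum of its own Fourier coefficients, since the difference
  is orthogonal to the basis.\<close>

lemma orthonormal_basis_closed_span:
  assumes B: "orthonormal_basis H S B" and S: "subspace_of H S" "hclosed H S"
    and S': "subspace_of H S'" "hclosed H S'" "B \<subseteq> S'"
  shows "S \<subseteq> S'"
proof
  fix x assume x: "x \<in> S"
  have xH: "x \<in> carrier H" using S(1) x subspaceD(2) by blast
  have on: "orthonormal H B" "B \<subseteq> S" using B by (auto simp: orthonormal_basis_def)
  have BH: "B \<subseteq> carrier H" using on by (auto simp: orthonormal_def)
  obtain y where y: "y \<in> carrier H" "\<And>b. b \<in> B \<Longrightarrow> cinner H y b = cinner H x b"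
    "\<And>S. hclosed H S \<Longrightarrow> subspace_of H S \<Longrightarrow> B \<subseteq> S \<Longrightarrow> y \<in> S"
    using riesz_fischer[OF on(1) bessel_summable(1)[OF on(1) xH]] by metis
  have "x \<ominus> y = \<zero>"
  proof (rule orthonormal_basis_total[OF B S(1)])
    show "x \<ominus> y \<in> S" using x y(3)[OF S(2,1) on(2)] subspaceD(5)[OF S(1)] by blast
    show "cinner H (x \<ominus> y) b = 0" if "b \<in> B" for b
      using that xH y BH by (auto simp: cinner_left)
  qed
  then have "x = y" using xH y(1) hnorm_diff_zeroD[of x y] by simp
  then show "x \<in> S'" using y(3) S' by blast
qed

text \<open>The projection is the Riesz-Fischer sum of the Fourier coefficients with respect to a basis
  of \<open>S\<close>. The remainder is orthogonal to the basis, and the vectors orthogonal to the remainder form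
  a closed subspace, which therefore contains \<open>S\<close>.\<close>

lemma orthogonal_projection:
  assumes S: "subspace_of H S" "hclosed H S" and x: "x \<in> carrier H"
  shows "\<exists>r\<in>S. x \<ominus> r \<in> orth_compl H S"
proof -
  obtain B where B: "orthonormal_basis H S B" using orthonormal_basis_exists by blast
  have on: "orthonormal H B" "B \<subseteq> S" using B by (auto simp: orthonormal_basis_def)
  have BH: "B \<subseteq> carrier H" using on by (auto simp: orthonormal_def)
  obtain r where r: "r \<in> carrier H" "\<And>b. b \<in> B \<Longrightarrow> cinner H r b = cinner H x b"
    "\<And>S. hclosed H S \<Longrightarrow> subspace_of H S \<Longrightarrow> B \<subseteq> S \<Longrightarrow> r \<in> S"
    using riesz_fischer[OF on(1) bessel_summable(1)[OF on(1) x]] by metis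
  have d: "x \<ominus> r \<in> carrier H" using x r(1) by simp
  have xr: "cinner H (x \<ominus> r) b = 0" if "b \<in> B" for b
    using that x r BH by (auto simp: cinner_left)
  have "S \<subseteq> orth_compl H {x \<ominus> r}"
  proof (rule orthonormal_basis_closed_span[OF B S])
    show "subspace_of H (orth_compl H {x \<ominus> r})" using d by (intro subspace_orth_compl) auto
    show "hclosed H (orth_compl H {x \<ominus> r})" using d by (intro hclosed_orth_compl) auto
    show "B \<subseteq> orth_compl H {x \<ominus> r}"
      using xr BH cinner_commute[OF _ d] by (auto simp: orth_compl_def)
  qed
  then have "x \<ominus> r \<in> orth_compl H S"
    using d subspaceD(2)[OF S(1)] cinner_commute[OF d] by (auto simp: orth_compl_def)
  then show ?thesis using r(3)[OF S(2,1) on(2)] by blast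
qed

end

section \<open>Deficiency, nullity and operators between prescribed subspaces\<close>

lemma cfinite_card_of: "BNF_Cardinal_Arithmetic.cfinite |B| \<longleftrightarrow> finite B"
  by (simp add: BNF_Cardinal_Arithmetic.cfinite_def Field_card_of)

lemma cinfinite_card_of: "cinfinite |B| \<longleftrightarrow> infinite B"
  by (simp add: cinfinite_def Field_card_of)

context complex_prehilbert_space
begin

lemma orthonormal_basis_hilbert_dim:
  obtains B where "orthonormal_basis H S B" "hilbert_dim H S = |B|"
proof
  show "orthonormal_basis H S (SOME B. orthonormal_basis H S B)"
    using orthonormal_basis_exists by (rule someI_ex)
qed (simp add: hilbert_dim_def)

lemma finite_orthonormal_basis_expansion:
  assumes B: "orthonormal_basis H S B" and "finite B" and S: "subspace_of H S" and x: "x \<in> S"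
  shows "x \<ominus> (\<Oplus>b\<in>B. cinner H x b \<odot> b) = \<zero>"
proof (rule orthonormal_basis_total[OF B S])
  have on: "orthonormal H B" and BS: "B \<subseteq> S" using B by (auto simp: orthonormal_basis_def)
  have xH: "x \<in> carrier H" and BH: "B \<subseteq> carrier H"
    using x subspaceD(2)[OF S] on by (auto simp: orthonormal_def)
  have "(\<Oplus>b\<in>B. cinner H x b \<odot> b) \<in> S"
    by (rule subspace_finsum[OF S \<open>finite B\<close>], rule funcsetI) (use BS subspaceD(6)[OF S] in blast)
  then show "x \<ominus> (\<Oplus>b\<in>B. cinner H x b \<odot> b) \<in> S" using subspaceD(5)[OF S] x by blast
  fix b assume b: "b \<in> B"
  have "cinner H (\<Oplus>b\<in>B. cinner H x b \<odot> b) b = cinner H x b"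
    using cinner_lincomb_orthonormal[OF on \<open>finite B\<close> order_refl b, of "cinner H x"] b by simp
  moreover have "b \<in> carrier H" using b BH by blast
  ultimately show "cinner H (x \<ominus> (\<Oplus>b\<in>B. cinner H x b \<odot> b)) b = 0"
    using xH BH by (simp add: cinner_diff_left)
qed

lemma subspace_zero: "subspace_of H {\<zero>}"
  by (rule subspaceI) auto

lemma almost_below_zero_if_finite_dim:
  assumes S: "subspace_of H S" and "\<not> cinfinite (hilbert_dim H S)"
  shows "almost_below H S {\<zero>}"
proof -
  obtain B where B: "orthonormal_basis H S B" "hilbert_dim H S = |B|"
    by (rule orthonormal_basis_hilbert_dim)
  have fin: "finite B" using assms(2) B(2) by (simp add: cinfinite_card_of)
  have BH: "B \<subseteq> carrier H" using B(1) by (auto simp: orthonormal_basis_def orthonormal_def)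
  show ?thesis
  proof (rule almost_below_finite_span[OF fin BH subspace_zero])
    show "\<exists>c. x \<ominus> (\<Oplus>b\<in>B. c b \<odot> b) \<in> {\<zero>}" if "x \<in> S" for x
      using finite_orthonormal_basis_expansion[OF B(1) fin S that]
      by (intro exI[of _ "cinner H x"]) simp
  qed (rule subspaceD(1)[OF S])
qed

end

lemma kernel_alt: "a_kernel H K T = {x \<in> carrier H. T x = \<zero>\<^bsub>K\<^esub>}"
  by (simp add: a_kernel_def')

lemma subspace_kernel:
  assumes "T \<in> linear_ops H K" "complex_prehilbert_space H" "complex_prehilbert_space K"
  shows "subspace_of H (a_kernel H K T)"
  using subspace_vimage[OF assms complex_prehilbert_space.subspace_carrier[OF assms(2)]
      complex_prehilbert_space.subspace_zero[OF assms(3)]]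
  by (simp add: kernel_alt)

lemma hclosed_kernel:
  assumes T: "T \<in> bounded_ops H K" and "complex_prehilbert_space H" "complex_prehilbert_space K"
  shows "hclosed H (a_kernel H K T)"
proof -
  interpret H: complex_prehilbert_space H by fact
  interpret K: complex_prehilbert_space K by fact
  have lin: "T \<in> linear_ops H K" using T by (rule bounded_ops_linear)
  note D = linear_opsD[OF lin]
  obtain C where C: "\<And>x. x \<in> carrier H \<Longrightarrow> hnorm K (T x) \<le> C * hnorm H x"
    using T unfolding bounded_ops_def by blast
  show ?thesis
  proof (rule H.hclosedI)
    fix u l assume u: "\<And>k. u k \<in> a_kernel H K T" and l: "hlim H u l"
    have uH: "u k \<in> carrier H" "T (u k) = \<zero>\<^bsub>K\<^esub>" for k using u[of k] by (auto simp: kernel_alt)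
    have lH: "l \<in> carrier H" using l by (simp add: hlim_def)
    have le: "hnorm K (T l) \<le> C * hnorm H (u k \<ominus>\<^bsub>H\<^esub> l)" for k
    proof -
      have "T (l \<ominus>\<^bsub>H\<^esub> u k) = T l \<ominus>\<^bsub>K\<^esub> \<zero>\<^bsub>K\<^esub>"
        using linear_ops_diff[OF lin assms(2,3) lH uH(1)] uH(2) by simp
      also have "\<dots> = T l" using D(1)[OF lH] by (rule K.diff_zero)
      finally have "hnorm K (T l) = hnorm K (T (l \<ominus>\<^bsub>H\<^esub> u k))" by simp
      also have "\<dots> \<le> C * hnorm H (l \<ominus>\<^bsub>H\<^esub> u k)" using C lH uH by simp
      finally show ?thesis using H.hnorm_minus_commute[OF lH uH(1)] by simp
    qed
    have "(\<lambda>k. C * hnorm H (u k \<ominus>\<^bsub>H\<^esub> l)) \<longlonglongrightarrow> C * 0"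
      using l by (intro tendsto_intros) (simp add: hlim_def)
    then have "(\<lambda>k. C * hnorm H (u k \<ominus>\<^bsub>H\<^esub> l)) \<longlonglongrightarrow> 0" by simp
    then have "hnorm K (T l) \<le> 0"
      by (rule LIMSEQ_le_const) (intro exI[of _ 0] allI impI le)
    then have "T l = \<zero>\<^bsub>K\<^esub>"
      using K.hnorm_nonneg[OF D(1)[OF lH]] by (intro K.hnorm_eq_zeroD[OF D(1)[OF lH]]) linarith
    then show "l \<in> a_kernel H K T" using lH by (simp add: kernel_alt)
  qed (auto simp: kernel_alt)
qed

text \<open>An orthonormal basis of the orthogonal complement of a closed range is independent modulo the
  range, hence finite if the codimension is. Conversely, if it is finite, it spans what is left of a
  vector after subtracting its projection onto the range. For a range that is not closed, the
  deficiency is an algebraic codimension by definition.\<close>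

lemma (in complex_hilbert_space) cfinite_deficiency_iff:
  assumes T: "T \<in> linear_ops H H"
  shows "BNF_Cardinal_Arithmetic.cfinite (deficiency H T) \<longleftrightarrow> almost_below H (carrier H) (op_range H T)"
proof -
  define R where "R = op_range H T"
  have pre: "complex_prehilbert_space H" by unfold_locales
  have R: "subspace_of H R" unfolding R_def by (rule subspace_image[OF T pre pre subspace_carrier])
  have RH: "R \<subseteq> carrier H" by (rule subspaceD(1)[OF R])
  show ?thesis
  proof (cases "hclosed H R")
    case False
    then show ?thesis using cfinite_quotient_dim_iff[OF R] unfolding deficiency_def R_def by simp
  next
    case True
    define M where "M = orth_compl H R"
    have M: "subspace_of H M" unfolding M_def by (rule subspace_orth_compl[OF RH])
    obtain B where B: "orthonormal_basis H M B" "hilbert_dim H M = |B|"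
      by (rule orthonormal_basis_hilbert_dim)
    have on: "orthonormal H B" and BM: "B \<subseteq> M" using B(1) by (auto simp: orthonormal_basis_def)
    have BH: "B \<subseteq> carrier H" using on by (auto simp: orthonormal_def)
    have "BNF_Cardinal_Arithmetic.cfinite (deficiency H T) \<longleftrightarrow> finite B"
      using True B(2) unfolding deficiency_def R_def[symmetric] M_def[symmetric]
      by (simp add: cfinite_card_of)
    also have "\<dots> \<longleftrightarrow> almost_below H (carrier H) R"
    proof
      assume fin: "finite B"
      show "almost_below H (carrier H) R"
      proof (rule almost_below_finite_span[OF fin BH R])
        fix x assume x: "x \<in> carrier H"
        obtain r where r: "r \<in> R" "x \<ominus> r \<in> M"
          using orthogonal_projection[OF R True x] unfolding M_def by blast
        define p where "p = (\<Oplus>b\<in>B. cinner H (x \<ominus> r) b \<odot> b)"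
        have c: "r \<in> carrier H" "p \<in> carrier H" using r(1) RH BH by (auto simp: p_def)
        have "(x \<ominus> r) \<ominus> p = \<zero>"
          unfolding p_def by (rule finite_orthonormal_basis_expansion[OF B(1) fin M r(2)])
        then have "x \<ominus> r = p" using x c hnorm_diff_zeroD[of "x \<ominus> r" p] by simp
        then have "x \<ominus> p = x \<ominus> (x \<ominus> r)" by simp
        also have "\<dots> = r" using x c by (intro cinner_ext) (auto simp: cinner_left)
        finally have "x \<ominus> p \<in> R" using r(1) by simp
        then show "\<exists>c. x \<ominus> (\<Oplus>b\<in>B. c b \<odot> b) \<in> R"
          unfolding p_def by (rule exI[of _ "cinner H (x \<ominus> r)"])
      qed simp
    next
      assume ab: "almost_below H (carrier H) R"
      have "independent_mod H R B"
      proof (rule independent_modI[OF BH])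
        fix F c b assume F: "finite F" "F \<subseteq> B" "(\<Oplus>b\<in>F. c b \<odot> b) \<in> R" "b \<in> F"
        have b: "b \<in> B" "b \<in> M" "b \<in> carrier H" using F BM BH by auto
        have "cinner H b (\<Oplus>b\<in>F. c b \<odot> b) = 0"
          using b(2) F(3) unfolding M_def orth_compl_def by blast
        then have "cinner H (\<Oplus>b\<in>F. c b \<odot> b) b = 0"
          using cinner_commute[of "\<Oplus>b\<in>F. c b \<odot> b" b] F(3) RH b(3) by auto
        then show "c b = 0"
          using cinner_lincomb_orthonormal[OF on F(1,2) b(1), of c] F(4) by simp
      qed
      then show "finite B" using independent_mod_finite[OF ab R] by blast
    qed
    finally show ?thesis unfolding R_def .
  qed
qed

text \<open>The comparison of dimensions gives an injection \<open>g\<close> from a basis \<open>E\<close> of \<open>M\<close> to a basis of \<open>N\<close>. The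
  operator sends \<open>x\<close> to the element of \<open>M\<close> whose coefficient at \<open>e\<close> is the coefficient of \<open>x\<close> at
  \<open>g e\<close>: it is a coisometry onto \<open>M\<close>, and the Riesz-Fischer theorem in \<open>K\<close> provides the preimages
  in \<open>N\<close>.\<close>

lemma bounded_op_onto:
  assumes "complex_hilbert_space H" "complex_hilbert_space K"
    and M: "subspace_of H M" "hclosed H M" and N: "subspace_of K N" "hclosed K N"
    and dim: "hilbert_dim H M \<le>o hilbert_dim K N"
  shows "\<exists>J\<in>bounded_ops K H. J ` carrier K \<subseteq> M \<and> M \<subseteq> J ` N"
proof -
  interpret H: complex_hilbert_space H by fact
  interpret K: complex_hilbert_space K by fact
  obtain E where E: "orthonormal_basis H M E" "hilbert_dim H M = |E|"
    by (rule H.orthonormal_basis_hilbert_dim)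
  obtain F where F: "orthonormal_basis K N F" "hilbert_dim K N = |F|"
    by (rule K.orthonormal_basis_hilbert_dim)
  from dim have "|E| \<le>o |F|" unfolding E(2) F(2) .
  then obtain g where g: "inj_on g E" "g ` E \<subseteq> F" unfolding card_of_ordLeq[symmetric] by blast
  have onE: "orthonormal H E" and EM: "E \<subseteq> M" using E(1) by (auto simp: orthonormal_basis_def)
  have EH: "E \<subseteq> carrier H" using onE by (auto simp: orthonormal_def)
  have onF: "orthonormal K F" and FN: "F \<subseteq> N" using F(1) by (auto simp: orthonormal_basis_def)
  have on: "orthonormal K (g ` E)" using onF g(2) unfolding orthonormal_def by blast
  have gK: "g e \<in> carrier K" if "e \<in> E" for e using that on by (auto simp: orthonormal_def)
  note MH = H.subspaceD(2)[OF M(1)]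
  define P where "P x y \<longleftrightarrow> y \<in> M \<and> (\<forall>e\<in>E. cinner H y e = cinner K x (g e))" for x y
  have unique: "y = y'" if P: "P x y" "P x y'" for x y y'
  proof -
    have yH: "y \<in> carrier H" "y' \<in> carrier H" using P MH by (auto simp: P_def)
    have "y \<ominus>\<^bsub>H\<^esub> y' = \<zero>\<^bsub>H\<^esub>"
    proof (rule H.orthonormal_basis_total[OF E(1) M(1)])
      show "y \<ominus>\<^bsub>H\<^esub> y' \<in> M" using P H.subspaceD(5)[OF M(1)] by (auto simp: P_def)
      show "cinner H (y \<ominus>\<^bsub>H\<^esub> y') e = 0" if "e \<in> E" for e
        using P that yH EH by (auto simp: P_def H.cinner_diff_left subset_iff)
    qed
    then show ?thesis using H.hnorm_diff_zeroD[OF yH] by simp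
  qed
  have ex: "\<exists>y. P x y \<and> hnorm H y \<le> hnorm K x" if x: "x \<in> carrier K" for x
  proof -
    let ?a = "\<lambda>e. cinner K x (g e)"
    note bs = K.bessel_summable[OF on x]
    have s: "(\<lambda>e. (cmod (?a e))\<^sup>2) summable_on E"
      using bs(1) summable_on_reindex[OF g(1), of "\<lambda>b. (cmod (cinner K x b))\<^sup>2"] by (simp add: o_def)
    have i: "infsum (\<lambda>e. (cmod (?a e))\<^sup>2) E \<le> (hnorm K x)\<^sup>2"
      using bs(2) infsum_reindex[OF g(1), of "\<lambda>b. (cmod (cinner K x b))\<^sup>2"] by (simp add: o_def)
    obtain y where y: "y \<in> carrier H" "\<And>b. b \<in> E \<Longrightarrow> cinner H y b = ?a b"
      "\<And>S. hclosed H S \<Longrightarrow> subspace_of H S \<Longrightarrow> E \<subseteq> S \<Longrightarrow> y \<in> S"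
      "(hnorm H y)\<^sup>2 \<le> infsum (\<lambda>b. (cmod (?a b))\<^sup>2) E"
      using H.riesz_fischer[OF onE s] by metis
    have "P x y" using y(2) y(3)[OF M(2,1) EM] by (simp add: P_def)
    moreover have "hnorm H y \<le> hnorm K x"
      by (rule power2_le_imp_le) (use y(4) i x in simp_all)
    ultimately show ?thesis by blast
  qed
  define J where "J x = (SOME y. P x y)" for x
  have J: "P x (J x)" if "x \<in> carrier K" for x
    unfolding J_def using ex[OF that] someI_ex[of "P x"] by blast
  have Jeq: "J x = y" if "x \<in> carrier K" "P x y" for x y
    using unique[OF J[OF that(1)] that(2)] .
  have JM: "J x \<in> M" "J x \<in> carrier H" if "x \<in> carrier K" for x
    using J[OF that] MH by (auto simp: P_def)
  have Jc: "cinner H (J x) e = cinner K x (g e)" if "x \<in> carrier K" "e \<in> E" for x e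
    using J[OF that(1)] that(2) by (simp add: P_def)
  have "J \<in> bounded_ops K H"
    unfolding bounded_ops_def
  proof (intro CollectI conjI ballI allI funcsetI exI[of _ 1])
    show "J x \<in> carrier H" if "x \<in> carrier K" for x using JM that by blast
    show "J (x \<oplus>\<^bsub>K\<^esub> y) = J x \<oplus>\<^bsub>H\<^esub> J y" if xy: "x \<in> carrier K" "y \<in> carrier K" for x y
    proof (rule Jeq)
      show "P (x \<oplus>\<^bsub>K\<^esub> y) (J x \<oplus>\<^bsub>H\<^esub> J y)"
        unfolding P_def
      proof (intro conjI ballI)
        show "J x \<oplus>\<^bsub>H\<^esub> J y \<in> M" using JM xy H.subspaceD(4)[OF M(1)] by blast
        fix e assume e: "e \<in> E"
        then have "e \<in> carrier H" using EH by blast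
        then show "cinner H (J x \<oplus>\<^bsub>H\<^esub> J y) e = cinner K (x \<oplus>\<^bsub>K\<^esub> y) (g e)"
          using xy JM gK[OF e] Jc e by (simp add: H.cinner_add_left K.cinner_add_left)
      qed
    qed (use xy in simp)
    show "J (c \<odot>\<^bsub>K\<^esub> x) = c \<odot>\<^bsub>H\<^esub> J x" if x: "x \<in> carrier K" for x c
    proof (rule Jeq)
      show "P (c \<odot>\<^bsub>K\<^esub> x) (c \<odot>\<^bsub>H\<^esub> J x)"
        unfolding P_def
      proof (intro conjI ballI)
        show "c \<odot>\<^bsub>H\<^esub> J x \<in> M" using JM x H.subspaceD(6)[OF M(1)] by blast
        fix e assume e: "e \<in> E"
        then have "e \<in> carrier H" using EH by blast
        then show "cinner H (c \<odot>\<^bsub>H\<^esub> J x) e = cinner K (c \<odot>\<^bsub>K\<^esub> x) (g e)"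
          using x JM gK[OF e] Jc e by (simp add: H.cinner_smult_left K.cinner_smult_left)
      qed
    qed (use x in simp)
    show "hnorm H (J x) \<le> 1 * hnorm K x" if x: "x \<in> carrier K" for x
      using ex[OF x] Jeq[OF x] by auto
  qed
  moreover have "J ` carrier K \<subseteq> M" using JM by blast
  moreover have "M \<subseteq> J ` N"
  proof
    fix y assume y: "y \<in> M"
    then have yH: "y \<in> carrier H" by (rule MH)
    define a where "a f = cinner H y (inv_into E g f)" for f
    have ag: "a (g e) = cinner H y e" if "e \<in> E" for e using that g(1) by (simp add: a_def)
    have "(\<lambda>e. (cmod (a (g e)))\<^sup>2) summable_on E"
      using H.bessel_summable(1)[OF onE yH] by (rule summable_on_cong[THEN iffD1, rotated]) (simp add: ag)
    then have s: "(\<lambda>f. (cmod (a f))\<^sup>2) summable_on g ` E"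
      using summable_on_reindex[OF g(1), of "\<lambda>f. (cmod (a f))\<^sup>2"] by (simp add: o_def)
    obtain x where x: "x \<in> carrier K" "\<And>f. f \<in> g ` E \<Longrightarrow> cinner K x f = a f"
      "\<And>S. hclosed K S \<Longrightarrow> subspace_of K S \<Longrightarrow> g ` E \<subseteq> S \<Longrightarrow> x \<in> S"
      using K.riesz_fischer[OF on s] by metis
    have "x \<in> N" using x(3)[OF N(2,1)] g(2) FN by blast
    moreover have "P x y" unfolding P_def using y x(2) ag by simp
    then have "J x = y" by (rule Jeq[OF x(1)])
    ultimately show "y \<in> J ` N" by blast
  qed
  ultimately show ?thesis by blast
qed

section \<open>Finite direct sums of Hilbert spaces\<close>

locale hilbert_family =
  fixes n :: nat and H :: "nat \<Rightarrow> 'a hilbert"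
  assumes summand: "s \<in> {1..n} \<Longrightarrow> complex_hilbert_space (H s)"
begin

abbreviation "DS \<equiv> direct_sum n H"

lemma summand_pre: "s \<in> {1..n} \<Longrightarrow> complex_prehilbert_space (H s)"
proof -
  assume "s \<in> {1..n}"
  then interpret complex_hilbert_space "H s" by (rule summand)
  show ?thesis by unfold_locales
qed

lemma ds_carrier: "carrier DS = (\<Pi>\<^sub>E i\<in>{1..n}. carrier (H i))"
  and ds_zero: "\<zero>\<^bsub>DS\<^esub> = (\<lambda>i\<in>{1..n}. \<zero>\<^bsub>H i\<^esub>)"
  and ds_add: "x \<oplus>\<^bsub>DS\<^esub> y = (\<lambda>i\<in>{1..n}. x i \<oplus>\<^bsub>H i\<^esub> y i)"
  and ds_smult: "c \<odot>\<^bsub>DS\<^esub> x = (\<lambda>i\<in>{1..n}. c \<odot>\<^bsub>H i\<^esub> x i)"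
  and ds_cinner: "cinner DS x y = (\<Sum>i\<in>{1..n}. cinner (H i) (x i) (y i))"
  by (simp_all add: direct_sum_def)

lemma ds_mem: "x \<in> carrier DS \<Longrightarrow> i \<in> {1..n} \<Longrightarrow> x i \<in> carrier (H i)"
  by (auto simp: ds_carrier)

lemma ds_eqI:
  assumes "x \<in> carrier DS" "y \<in> carrier DS" "\<And>i. i \<in> {1..n} \<Longrightarrow> x i = y i"
  shows "x = y"
  using assms unfolding ds_carrier by (rule PiE_ext)

lemma ds_restrict: "(\<And>i. i \<in> {1..n} \<Longrightarrow> f i \<in> carrier (H i)) \<Longrightarrow> restrict f {1..n} \<in> carrier DS"
  by (auto simp: ds_carrier)

lemma ds_closed:
  "\<zero>\<^bsub>DS\<^esub> \<in> carrier DS"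
  "x \<in> carrier DS \<Longrightarrow> y \<in> carrier DS \<Longrightarrow> x \<oplus>\<^bsub>DS\<^esub> y \<in> carrier DS"
  "x \<in> carrier DS \<Longrightarrow> c \<odot>\<^bsub>DS\<^esub> x \<in> carrier DS"
proof -
  show "\<zero>\<^bsub>DS\<^esub> \<in> carrier DS"
    unfolding ds_zero
  proof (rule ds_restrict)
    fix i assume "i \<in> {1..n}"
    then interpret complex_hilbert_space "H i" by (rule summand)
    show "\<zero>\<^bsub>H i\<^esub> \<in> carrier (H i)" by simp
  qed
  show "x \<oplus>\<^bsub>DS\<^esub> y \<in> carrier DS" if xy: "x \<in> carrier DS" "y \<in> carrier DS"
    unfolding ds_add
  proof (rule ds_restrict)
    fix i assume i: "i \<in> {1..n}"
    then interpret complex_hilbert_space "H i" by (rule summand)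
    show "x i \<oplus>\<^bsub>H i\<^esub> y i \<in> carrier (H i)" using ds_mem[OF xy(1) i] ds_mem[OF xy(2) i] by simp
  qed
  show "c \<odot>\<^bsub>DS\<^esub> x \<in> carrier DS" if x: "x \<in> carrier DS"
    unfolding ds_smult
  proof (rule ds_restrict)
    fix i assume i: "i \<in> {1..n}"
    then interpret complex_hilbert_space "H i" by (rule summand)
    show "c \<odot>\<^bsub>H i\<^esub> x i \<in> carrier (H i)" using ds_mem[OF x i] by simp
  qed
qed

lemma ds_module: "Module.module (ring_of_type_algebra :: complex ring) DS"
proof (rule moduleI)
  show "cring (ring_of_type_algebra :: complex ring)" by (rule cring_from_type_algebra)
  show "abelian_group DS"
  proof (rule abelian_groupI)
    fix x y z assume x: "x \<in> carrier DS" and y: "y \<in> carrier DS" and z: "z \<in> carrier DS"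
    show "x \<oplus>\<^bsub>DS\<^esub> y \<oplus>\<^bsub>DS\<^esub> z = x \<oplus>\<^bsub>DS\<^esub> (y \<oplus>\<^bsub>DS\<^esub> z)"
    proof (rule ds_eqI)
      fix i assume i: "i \<in> {1..n}"
      then interpret complex_hilbert_space "H i" by (rule summand)
      show "(x \<oplus>\<^bsub>DS\<^esub> y \<oplus>\<^bsub>DS\<^esub> z) i = (x \<oplus>\<^bsub>DS\<^esub> (y \<oplus>\<^bsub>DS\<^esub> z)) i"
        using i ds_mem[OF x i] ds_mem[OF y i] ds_mem[OF z i] by (simp add: ds_add a_assoc)
    qed (use x y z in \<open>auto intro!: ds_closed\<close>)
  next
    fix x y assume x: "x \<in> carrier DS" and y: "y \<in> carrier DS"
    show "x \<oplus>\<^bsub>DS\<^esub> y = y \<oplus>\<^bsub>DS\<^esub> x"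
    proof (rule ds_eqI)
      fix i assume i: "i \<in> {1..n}"
      then interpret complex_hilbert_space "H i" by (rule summand)
      show "(x \<oplus>\<^bsub>DS\<^esub> y) i = (y \<oplus>\<^bsub>DS\<^esub> x) i"
        using i ds_mem[OF x i] ds_mem[OF y i] by (simp add: ds_add a_comm)
    qed (use x y in \<open>auto intro!: ds_closed\<close>)
  next
    fix x assume x: "x \<in> carrier DS"
    show "\<zero>\<^bsub>DS\<^esub> \<oplus>\<^bsub>DS\<^esub> x = x"
    proof (rule ds_eqI)
      fix i assume i: "i \<in> {1..n}"
      then interpret complex_hilbert_space "H i" by (rule summand)
      show "(\<zero>\<^bsub>DS\<^esub> \<oplus>\<^bsub>DS\<^esub> x) i = x i"
        using i ds_mem[OF x i] by (simp add: ds_add ds_zero)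
    qed (use x in \<open>auto intro!: ds_closed\<close>)
    have "(-1) \<odot>\<^bsub>DS\<^esub> x \<oplus>\<^bsub>DS\<^esub> x = \<zero>\<^bsub>DS\<^esub>"
    proof (rule ds_eqI)
      fix i assume i: "i \<in> {1..n}"
      then interpret complex_hilbert_space "H i" by (rule summand)
      have "(-1) \<odot>\<^bsub>H i\<^esub> x i \<oplus>\<^bsub>H i\<^esub> x i = \<zero>\<^bsub>H i\<^esub>"
        using ds_mem[OF x i] by (intro cinner_ext) (auto simp: cinner_left)
      then show "((-1) \<odot>\<^bsub>DS\<^esub> x \<oplus>\<^bsub>DS\<^esub> x) i = \<zero>\<^bsub>DS\<^esub> i"
        using i by (simp add: ds_add ds_zero ds_smult)
    qed (use x in \<open>auto intro!: ds_closed\<close>)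
    then show "\<exists>y\<in>carrier DS. y \<oplus>\<^bsub>DS\<^esub> x = \<zero>\<^bsub>DS\<^esub>"
      using ds_closed(3)[OF x] by blast
  qed (auto intro: ds_closed)
next
  fix a b :: complex and x y assume x: "x \<in> carrier DS"
  show "(a \<oplus>\<^bsub>ring_of_type_algebra\<^esub> b) \<odot>\<^bsub>DS\<^esub> x = a \<odot>\<^bsub>DS\<^esub> x \<oplus>\<^bsub>DS\<^esub> b \<odot>\<^bsub>DS\<^esub> x"
  proof (rule ds_eqI)
    fix i assume i: "i \<in> {1..n}"
    then interpret complex_hilbert_space "H i" by (rule summand)
    show "((a \<oplus>\<^bsub>ring_of_type_algebra\<^esub> b) \<odot>\<^bsub>DS\<^esub> x) i = (a \<odot>\<^bsub>DS\<^esub> x \<oplus>\<^bsub>DS\<^esub> b \<odot>\<^bsub>DS\<^esub> x) i"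
      using i ds_mem[OF x i] smult_l_distr[of a b "x i"]
      by (simp add: ds_add ds_smult ring_of_type_algebra_def)
  qed (use x in \<open>auto intro!: ds_closed\<close>)
  show "(a \<otimes>\<^bsub>ring_of_type_algebra\<^esub> b) \<odot>\<^bsub>DS\<^esub> x = a \<odot>\<^bsub>DS\<^esub> (b \<odot>\<^bsub>DS\<^esub> x)"
  proof (rule ds_eqI)
    fix i assume i: "i \<in> {1..n}"
    then interpret complex_hilbert_space "H i" by (rule summand)
    show "((a \<otimes>\<^bsub>ring_of_type_algebra\<^esub> b) \<odot>\<^bsub>DS\<^esub> x) i = (a \<odot>\<^bsub>DS\<^esub> (b \<odot>\<^bsub>DS\<^esub> x)) i"
      using i ds_mem[OF x i] by (simp add: ds_smult ring_of_type_algebra_def)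
  qed (use x in \<open>auto intro!: ds_closed\<close>)
  show "\<one>\<^bsub>ring_of_type_algebra :: complex ring\<^esub> \<odot>\<^bsub>DS\<^esub> x = x"
  proof (rule ds_eqI)
    fix i assume i: "i \<in> {1..n}"
    then interpret complex_hilbert_space "H i" by (rule summand)
    show "(\<one>\<^bsub>ring_of_type_algebra :: complex ring\<^esub> \<odot>\<^bsub>DS\<^esub> x) i = x i"
      using i ds_mem[OF x i] by (simp add: ds_smult ring_of_type_algebra_def)
  qed (use x in \<open>auto intro!: ds_closed\<close>)
  assume y: "y \<in> carrier DS"
  show "a \<odot>\<^bsub>DS\<^esub> (x \<oplus>\<^bsub>DS\<^esub> y) = a \<odot>\<^bsub>DS\<^esub> x \<oplus>\<^bsub>DS\<^esub> a \<odot>\<^bsub>DS\<^esub> y"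
  proof (rule ds_eqI)
    fix i assume i: "i \<in> {1..n}"
    then interpret complex_hilbert_space "H i" by (rule summand)
    show "(a \<odot>\<^bsub>DS\<^esub> (x \<oplus>\<^bsub>DS\<^esub> y)) i = (a \<odot>\<^bsub>DS\<^esub> x \<oplus>\<^bsub>DS\<^esub> a \<odot>\<^bsub>DS\<^esub> y) i"
      using i ds_mem[OF x i] ds_mem[OF y i] smult_r_distr[of a "x i" "y i"]
      by (simp add: ds_add ds_smult ring_of_type_algebra_def)
  qed (use x y in \<open>auto intro!: ds_closed\<close>)
qed (auto intro: ds_closed)

lemma ds_prehilbert: "complex_prehilbert_space DS"
proof (rule complex_prehilbert_space.intro[OF ds_module], unfold_locales)
  fix x y assume x: "x \<in> carrier DS" and y: "y \<in> carrier DS"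
  show "cinner DS x y = cnj (cinner DS y x)"
    unfolding ds_cinner cnj_sum
  proof (rule sum.cong)
    fix i assume i: "i \<in> {1..n}"
    then interpret complex_hilbert_space "H i" by (rule summand)
    show "cinner (H i) (x i) (y i) = cnj (cinner (H i) (y i) (x i))"
      using ds_mem[OF x i] ds_mem[OF y i] by (rule cinner_commute)
  qed simp
  show "cinner DS (c \<odot>\<^bsub>DS\<^esub> x) y = c * cinner DS x y" for c
    unfolding ds_cinner sum_distrib_left
  proof (rule sum.cong)
    fix i assume i: "i \<in> {1..n}"
    then interpret complex_hilbert_space "H i" by (rule summand)
    show "cinner (H i) ((c \<odot>\<^bsub>DS\<^esub> x) i) (y i) = c * cinner (H i) (x i) (y i)"
      using i ds_mem[OF x i] ds_mem[OF y i] by (simp add: ds_smult cinner_smult_left)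
  qed simp
  show "cinner DS (x \<oplus>\<^bsub>DS\<^esub> y) z = cinner DS x z + cinner DS y z" if z: "z \<in> carrier DS" for z
    unfolding ds_cinner sum.distrib[symmetric]
  proof (rule sum.cong)
    fix i assume i: "i \<in> {1..n}"
    then interpret complex_hilbert_space "H i" by (rule summand)
    show "cinner (H i) ((x \<oplus>\<^bsub>DS\<^esub> y) i) (z i) = cinner (H i) (x i) (z i) + cinner (H i) (y i) (z i)"
      using i ds_mem[OF x i] ds_mem[OF y i] ds_mem[OF z i] by (simp add: ds_add cinner_add_left)
  qed simp
next
  fix x assume x: "x \<in> carrier DS"
  have nn: "0 \<le> Re (cinner (H i) (x i) (x i))" if i: "i \<in> {1..n}" for i
  proof -
    from i interpret complex_hilbert_space "H i" by (rule summand)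
    show ?thesis using ds_mem[OF x i] by (rule cinner_ge_zero)
  qed
  show "0 \<le> Re (cinner DS x x)"
    unfolding ds_cinner Re_sum by (rule sum_nonneg) (rule nn)
  assume "cinner DS x x = 0"
  then have "(\<Sum>i\<in>{1..n}. Re (cinner (H i) (x i) (x i))) = 0"
    unfolding ds_cinner by (simp flip: Re_sum)
  then have z: "Re (cinner (H i) (x i) (x i)) = 0" if "i \<in> {1..n}" for i
    using sum_nonneg_eq_0_iff[of "{1..n}" "\<lambda>i. Re (cinner (H i) (x i) (x i))"] nn that by simp
  show "x = \<zero>\<^bsub>DS\<^esub>"
  proof (rule ds_eqI[OF x ds_closed(1)])
    fix i assume i: "i \<in> {1..n}"
    then interpret complex_hilbert_space "H i" by (rule summand)
    have "x i = \<zero>\<^bsub>H i\<^esub>"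
      using z[OF i] ds_mem[OF x i] by (intro hnorm_eq_zeroD) (simp_all add: hnorm_def)
    then show "x i = \<zero>\<^bsub>DS\<^esub> i" using i by (simp add: ds_zero)
  qed
qed

sublocale DS: complex_prehilbert_space DS
  by (rule ds_prehilbert)

lemma proj_linear: "i \<in> {1..n} \<Longrightarrow> (\<lambda>x. x i) \<in> linear_ops DS (H i)"
  unfolding linear_ops_def by (simp add: ds_mem ds_add ds_smult)

lemma ds_diff: "x \<in> carrier DS \<Longrightarrow> y \<in> carrier DS \<Longrightarrow> i \<in> {1..n} \<Longrightarrow> (x \<ominus>\<^bsub>DS\<^esub> y) i = x i \<ominus>\<^bsub>H i\<^esub> y i"
  by (rule linear_ops_diff[OF proj_linear ds_prehilbert summand_pre])

lemma ds_hnorm: "x \<in> carrier DS \<Longrightarrow> hnorm DS x = L2_set (\<lambda>i. hnorm (H i) (x i)) {1..n}"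
proof -
  assume x: "x \<in> carrier DS"
  have "Re (cinner (H i) (x i) (x i)) = (hnorm (H i) (x i))\<^sup>2" if i: "i \<in> {1..n}" for i
  proof -
    from i interpret complex_hilbert_space "H i" by (rule summand)
    show ?thesis using hnorm_sq[OF ds_mem[OF x i]] by simp
  qed
  then show ?thesis unfolding hnorm_def[of DS] ds_cinner L2_set_def Re_sum by simp
qed

lemma ds_hilbert: "complex_hilbert_space DS"
proof (unfold_locales)
  show "Metric_space.mcomplete (carrier DS) (hdist DS)"
    unfolding DS.mcomplete_iff_Cauchy_hlim
  proof (intro allI impI, elim conjE)
    fix u :: "nat \<Rightarrow> nat \<Rightarrow> 'a"
    assume u: "\<forall>k. u k \<in> carrier DS"
      and C: "\<forall>e>0. \<exists>N. \<forall>m\<ge>N. \<forall>k\<ge>N. hnorm DS (u m \<ominus>\<^bsub>DS\<^esub> u k) < e"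
    have "\<exists>l. hlim (H i) (\<lambda>k. u k i) l" if i: "i \<in> {1..n}" for i
    proof -
      from i interpret complex_hilbert_space "H i" by (rule summand)
      have le: "hnorm (H i) (u m i \<ominus>\<^bsub>H i\<^esub> u k i) \<le> hnorm DS (u m \<ominus>\<^bsub>DS\<^esub> u k)" for m k
      proof -
        have "hnorm (H i) ((u m \<ominus>\<^bsub>DS\<^esub> u k) i) \<le> hnorm DS (u m \<ominus>\<^bsub>DS\<^esub> u k)"
          using u i by (subst ds_hnorm) (auto intro!: member_le_L2_set)
        then show ?thesis using ds_diff[of "u m" "u k" i] u i by simp
      qed
      show ?thesis
      proof (rule Cauchy_hlim)
        show "u k i \<in> carrier (H i)" for k using u i ds_mem by blast
        fix e :: real assume "e > 0"
        then obtain N where N: "\<forall>m\<ge>N. \<forall>k\<ge>N. hnorm DS (u m \<ominus>\<^bsub>DS\<^esub> u k) < e" using C by blast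
        show "\<exists>N. \<forall>m\<ge>N. \<forall>k\<ge>N. hnorm (H i) (u m i \<ominus>\<^bsub>H i\<^esub> u k i) < e"
        proof (intro exI[of _ N] allI impI)
          fix m k assume "m \<ge> N" "k \<ge> N"
          then have "hnorm DS (u m \<ominus>\<^bsub>DS\<^esub> u k) < e" using N by simp
          then show "hnorm (H i) (u m i \<ominus>\<^bsub>H i\<^esub> u k i) < e" using le[of m k] by linarith
        qed
      qed
    qed
    then obtain l where l: "\<And>i. i \<in> {1..n} \<Longrightarrow> hlim (H i) (\<lambda>k. u k i) (l i)" by metis
    define l' where "l' = restrict l {1..n}"
    have l': "l' \<in> carrier DS" unfolding l'_def using l by (intro ds_restrict) (simp add: hlim_def)
    have le: "hnorm DS (u k \<ominus>\<^bsub>DS\<^esub> l') \<le> (\<Sum>i\<in>{1..n}. hnorm (H i) (u k i \<ominus>\<^bsub>H i\<^esub> l i))" for k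
    proof -
      have uk: "u k \<ominus>\<^bsub>DS\<^esub> l' \<in> carrier DS" using u l' by simp
      have nn: "0 \<le> hnorm (H i) ((u k \<ominus>\<^bsub>DS\<^esub> l') i)" if i: "i \<in> {1..n}" for i
      proof -
        from i interpret complex_hilbert_space "H i" by (rule summand)
        show ?thesis using ds_mem[OF uk i] by (rule hnorm_nonneg)
      qed
      have "hnorm DS (u k \<ominus>\<^bsub>DS\<^esub> l') \<le> (\<Sum>i\<in>{1..n}. hnorm (H i) ((u k \<ominus>\<^bsub>DS\<^esub> l') i))"
        unfolding ds_hnorm[OF uk] by (rule L2_set_le_sum) (rule nn)
      also have "\<dots> = (\<Sum>i\<in>{1..n}. hnorm (H i) (u k i \<ominus>\<^bsub>H i\<^esub> l i))"
        using u l' by (intro sum.cong) (simp_all add: ds_diff, simp add: l'_def)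
      finally show ?thesis .
    qed
    have "(\<lambda>k. \<Sum>i\<in>{1..n}. hnorm (H i) (u k i \<ominus>\<^bsub>H i\<^esub> l i)) \<longlonglongrightarrow> (\<Sum>i\<in>{1..n}. 0)"
      using l by (intro tendsto_sum) (simp add: hlim_def)
    then have "(\<lambda>k. \<Sum>i\<in>{1..n}. hnorm (H i) (u k i \<ominus>\<^bsub>H i\<^esub> l i)) \<longlonglongrightarrow> 0" by simp
    then have "(\<lambda>k. hnorm DS (u k \<ominus>\<^bsub>DS\<^esub> l')) \<longlonglongrightarrow> 0"
      by (rule Lim_null_comparison[rotated]) (use le u l' in \<open>simp add: eventually_sequentially\<close>)
    then have "hlim DS u l'" using u l' by (simp add: hlim_def)
    then show "\<exists>l. hlim DS u l" by blast
  qed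
qed (rule DS.cinner_add_left DS.cinner_smult_left DS.cinner_commute DS.cinner_ge_zero
      DS.cinner_eq_zeroD; assumption)+

definition incl :: "nat \<Rightarrow> 'a \<Rightarrow> (nat \<Rightarrow> 'a)" where
  "incl s a = (\<lambda>i\<in>{1..n}. if i = s then a else \<zero>\<^bsub>H i\<^esub>)"

lemma incl_linear: assumes s: "s \<in> {1..n}" shows "incl s \<in> linear_ops (H s) DS"
proof -
  interpret S: complex_hilbert_space "H s" using s by (rule summand)
  have cl: "incl s a \<in> carrier DS" if "a \<in> carrier (H s)" for a
    unfolding incl_def
  proof (rule ds_restrict)
    fix i assume "i \<in> {1..n}"
    then interpret complex_hilbert_space "H i" by (rule summand)
    show "(if i = s then a else \<zero>\<^bsub>H i\<^esub>) \<in> carrier (H i)" using that by simp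
  qed
  have add: "incl s (a \<oplus>\<^bsub>H s\<^esub> b) = incl s a \<oplus>\<^bsub>DS\<^esub> incl s b"
    if ab: "a \<in> carrier (H s)" "b \<in> carrier (H s)" for a b
  proof (rule ds_eqI)
    fix i assume i: "i \<in> {1..n}"
    then interpret complex_hilbert_space "H i" by (rule summand)
    show "incl s (a \<oplus>\<^bsub>H s\<^esub> b) i = (incl s a \<oplus>\<^bsub>DS\<^esub> incl s b) i"
      using i by (simp add: incl_def ds_add)
  qed (use ab cl in auto)
  have sm: "incl s (c \<odot>\<^bsub>H s\<^esub> a) = c \<odot>\<^bsub>DS\<^esub> incl s a" if a: "a \<in> carrier (H s)" for a c
  proof (rule ds_eqI)
    fix i assume i: "i \<in> {1..n}"
    then interpret complex_hilbert_space "H i" by (rule summand)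
    show "incl s (c \<odot>\<^bsub>H s\<^esub> a) i = (c \<odot>\<^bsub>DS\<^esub> incl s a) i"
      using i by (simp add: incl_def ds_smult)
  qed (use a cl in auto)
  show ?thesis unfolding linear_ops_def using cl add sm by auto
qed

lemma incl_apply: "i \<in> {1..n} \<Longrightarrow> incl s a i = (if i = s then a else \<zero>\<^bsub>H i\<^esub>)"
  by (simp add: incl_def)

end

section \<open>Upper triangular block operators\<close>

lemma (in abelian_monoid) finsum_eq_single:
  assumes "finite I" "k \<in> I" "f k \<in> carrier G" "\<And>j. j \<in> I \<Longrightarrow> j \<noteq> k \<Longrightarrow> f j = \<zero>"
  shows "finsum G f I = f k"
proof -
  have "finsum G f I = (\<Oplus>j\<in>I. if k = j then f k else \<zero>)"
    by (rule finsum_cong') (use assms in auto)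
  also have "\<dots> = f k"
    using assms(3) by (intro finsum_singleton[OF assms(2,1)]) simp
  finally show ?thesis .
qed

lemma (in complex_prehilbert_space) hnorm_finsum_le:
  assumes "finite I" "f \<in> I \<rightarrow> carrier H"
  shows "hnorm H (finsum H f I) \<le> (\<Sum>i\<in>I. hnorm H (f i))"
  using assms
proof (induct I)
  case empty show ?case by simp
next
  case (insert i I)
  then have c: "f \<in> I \<rightarrow> carrier H" "f i \<in> carrier H" by auto
  then have "hnorm H (finsum H f (insert i I)) \<le> hnorm H (f i) + hnorm H (finsum H f I)"
    using insert(1,2) by (simp add: hnorm_triangle finsum_closed)
  then show ?case using insert c(1) by simp
qed

lemma zero_bounded:
  assumes "complex_hilbert_space H" "complex_hilbert_space K"
  shows "(\<lambda>_. \<zero>\<^bsub>K\<^esub>) \<in> bounded_ops H K"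
proof -
  interpret H: complex_hilbert_space H by fact
  interpret K: complex_hilbert_space K by fact
  have "\<forall>x\<in>carrier H. hnorm K \<zero>\<^bsub>K\<^esub> \<le> 0 * hnorm H x" by simp
  then have "\<exists>C. \<forall>x\<in>carrier H. hnorm K \<zero>\<^bsub>K\<^esub> \<le> C * hnorm H x" by (rule exI)
  then show ?thesis unfolding bounded_ops_def by simp
qed

locale triangular_family = hilbert_family +
  fixes D :: "nat \<Rightarrow> 'a \<Rightarrow> 'a"
  assumes diag: "s \<in> {1..n} \<Longrightarrow> D s \<in> bounded_ops (H s) (H s)"
begin

lemma diag_linear: "s \<in> {1..n} \<Longrightarrow> D s \<in> linear_ops (H s) (H s)"
  using diag bounded_ops_linear by blast

lemma entry_bounded:
  assumes A: "A \<in> upper_tuples n H" and ij: "i \<in> {1..n}" "j \<in> {1..n}"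
  shows "upper_entry H D A i j \<in> bounded_ops (H j) (H i)"
proof -
  consider "i = j" | "i < j" | "j < i" by linarith
  then show ?thesis
  proof cases
    case 1 then show ?thesis using diag ij by (simp add: upper_entry_def)
  next
    case 2 then show ?thesis using A ij unfolding upper_tuples_def upper_entry_def by simp
  next
    case 3 then show ?thesis using zero_bounded[OF summand summand] ij by (simp add: upper_entry_def)
  qed
qed

lemma entry_linear:
  "A \<in> upper_tuples n H \<Longrightarrow> i \<in> {1..n} \<Longrightarrow> j \<in> {1..n} \<Longrightarrow>
   upper_entry H D A i j \<in> linear_ops (H j) (H i)"
  using entry_bounded bounded_ops_linear by blast

lemma triangular_apply:
  "i \<in> {1..n} \<Longrightarrow> upper_triangular_op n H D A x i = finsum (H i) (\<lambda>j. upper_entry H D A i j (x j)) {1..n}"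
  by (simp add: upper_triangular_op_def)

lemma entry_mem:
  "A \<in> upper_tuples n H \<Longrightarrow> i \<in> {1..n} \<Longrightarrow> j \<in> {1..n} \<Longrightarrow> x \<in> carrier DS \<Longrightarrow>
   upper_entry H D A i j (x j) \<in> carrier (H i)"
  using linear_opsD(1)[OF entry_linear] ds_mem by blast

lemma triangular_closed:
  assumes A: "A \<in> upper_tuples n H" and x: "x \<in> carrier DS"
  shows "upper_triangular_op n H D A x \<in> carrier DS"
  unfolding upper_triangular_op_def
proof (rule ds_restrict)
  fix i assume i: "i \<in> {1..n}"
  then interpret complex_hilbert_space "H i" by (rule summand)
  show "(\<Oplus>\<^bsub>H i\<^esub>j\<in>{1..n}. upper_entry H D A i j (x j)) \<in> carrier (H i)"
    by (rule finsum_closed) (use entry_mem[OF A i _ x] in auto)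
qed

text \<open>Each entry is bounded by a multiple of the norm on the direct sum, and an \<open>\<ell>\<^sup>2\<close> norm is
  at most the sum of its components.\<close>

lemma triangular_bounded:
  assumes A: "A \<in> upper_tuples n H"
  shows "upper_triangular_op n H D A \<in> bounded_ops DS DS"
proof -
  let ?T = "upper_triangular_op n H D A"
  note cl = triangular_closed[OF A]
  have add: "?T (x \<oplus>\<^bsub>DS\<^esub> y) = ?T x \<oplus>\<^bsub>DS\<^esub> ?T y" if x: "x \<in> carrier DS" and y: "y \<in> carrier DS" for x y
  proof (rule ds_eqI)
    fix i assume i: "i \<in> {1..n}"
    then interpret complex_hilbert_space "H i" by (rule summand)
    have "?T (x \<oplus>\<^bsub>DS\<^esub> y) i =
        (\<Oplus>\<^bsub>H i\<^esub>j\<in>{1..n}. upper_entry H D A i j (x j) \<oplus>\<^bsub>H i\<^esub> upper_entry H D A i j (y j))"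
      unfolding triangular_apply[OF i]
    proof (rule finsum_cong')
      fix j assume j: "j \<in> {1..n}"
      show "upper_entry H D A i j ((x \<oplus>\<^bsub>DS\<^esub> y) j)
          = upper_entry H D A i j (x j) \<oplus>\<^bsub>H i\<^esub> upper_entry H D A i j (y j)"
        using j linear_opsD(2)[OF entry_linear[OF A i j] ds_mem[OF x j] ds_mem[OF y j]]
        by (simp add: ds_add)
    qed (use entry_mem[OF A i _ x] entry_mem[OF A i _ y] in auto)
    also have "\<dots> = ?T x i \<oplus>\<^bsub>H i\<^esub> ?T y i"
      unfolding triangular_apply[OF i]
      by (rule finsum_addf) (use entry_mem[OF A i _ x] entry_mem[OF A i _ y] in auto)
    finally show "?T (x \<oplus>\<^bsub>DS\<^esub> y) i = (?T x \<oplus>\<^bsub>DS\<^esub> ?T y) i" using i by (simp add: ds_add)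
  qed (use x y cl in auto)
  have sm: "?T (c \<odot>\<^bsub>DS\<^esub> x) = c \<odot>\<^bsub>DS\<^esub> ?T x" if x: "x \<in> carrier DS" for x c
  proof (rule ds_eqI)
    fix i assume i: "i \<in> {1..n}"
    then interpret complex_hilbert_space "H i" by (rule summand)
    have "?T (c \<odot>\<^bsub>DS\<^esub> x) i = (\<Oplus>\<^bsub>H i\<^esub>j\<in>{1..n}. c \<odot>\<^bsub>H i\<^esub> upper_entry H D A i j (x j))"
      unfolding triangular_apply[OF i]
    proof (rule finsum_cong')
      fix j assume j: "j \<in> {1..n}"
      show "upper_entry H D A i j ((c \<odot>\<^bsub>DS\<^esub> x) j) = c \<odot>\<^bsub>H i\<^esub> upper_entry H D A i j (x j)"
        using j linear_opsD(3)[OF entry_linear[OF A i j] ds_mem[OF x j]] by (simp add: ds_smult)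
    qed (use entry_mem[OF A i _ x] in auto)
    also have "\<dots> = c \<odot>\<^bsub>H i\<^esub> ?T x i"
      unfolding triangular_apply[OF i]
      by (rule finsum_smult_ldistr[symmetric])
        (use entry_mem[OF A i _ x] in \<open>auto simp: ring_of_type_algebra_def\<close>)
    finally show "?T (c \<odot>\<^bsub>DS\<^esub> x) i = (c \<odot>\<^bsub>DS\<^esub> ?T x) i" using i by (simp add: ds_smult)
  qed (use x cl in auto)
  have "\<exists>C. \<forall>x\<in>carrier DS. hnorm (H i) (upper_entry H D A i j (x j)) \<le> C * hnorm DS x"
    if i: "i \<in> {1..n}" and j: "j \<in> {1..n}" for i j
  proof -
    interpret J: complex_hilbert_space "H j" using j by (rule summand)
    obtain C where C: "\<And>x. x \<in> carrier (H j) \<Longrightarrow> hnorm (H i) (upper_entry H D A i j x) \<le> C * hnorm (H j) x"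
      using entry_bounded[OF A i j] unfolding bounded_ops_def by blast
    have "hnorm (H i) (upper_entry H D A i j (x j)) \<le> \<bar>C\<bar> * hnorm DS x" if x: "x \<in> carrier DS" for x
    proof -
      have "hnorm (H i) (upper_entry H D A i j (x j)) \<le> C * hnorm (H j) (x j)"
        by (rule C[OF ds_mem[OF x j]])
      also have "\<dots> \<le> \<bar>C\<bar> * hnorm (H j) (x j)"
        using J.hnorm_nonneg[OF ds_mem[OF x j]] by (intro mult_right_mono) auto
      also have "\<dots> \<le> \<bar>C\<bar> * hnorm DS x"
        unfolding ds_hnorm[OF x] using j by (intro mult_left_mono member_le_L2_set) auto
      finally show ?thesis .
    qed
    then show ?thesis by blast
  qed
  then obtain C where C: "\<And>i j x. i \<in> {1..n} \<Longrightarrow> j \<in> {1..n} \<Longrightarrow> x \<in> carrier DS \<Longrightarrow>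
      hnorm (H i) (upper_entry H D A i j (x j)) \<le> C i j * hnorm DS x" by metis
  have bd: "hnorm DS (?T x) \<le> (\<Sum>i\<in>{1..n}. \<Sum>j\<in>{1..n}. C i j) * hnorm DS x" if x: "x \<in> carrier DS" for x
  proof -
    have c: "hnorm (H i) (?T x i) \<le> (\<Sum>j\<in>{1..n}. C i j) * hnorm DS x \<and> 0 \<le> hnorm (H i) (?T x i)"
      if i: "i \<in> {1..n}" for i
    proof -
      from i interpret complex_hilbert_space "H i" by (rule summand)
      have "hnorm (H i) (?T x i) \<le> (\<Sum>j\<in>{1..n}. hnorm (H i) (upper_entry H D A i j (x j)))"
        unfolding triangular_apply[OF i]
        by (rule hnorm_finsum_le) (use entry_mem[OF A i _ x] in auto)
      also have "\<dots> \<le> (\<Sum>j\<in>{1..n}. C i j * hnorm DS x)"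
        by (rule sum_mono) (rule C[OF i _ x])
      finally show ?thesis
        using hnorm_nonneg[OF ds_mem[OF cl[OF x] i]] by (simp add: sum_distrib_right)
    qed
    have "hnorm DS (?T x) \<le> (\<Sum>i\<in>{1..n}. hnorm (H i) (?T x i))"
      unfolding ds_hnorm[OF cl[OF x]] by (rule L2_set_le_sum) (use c in blast)
    also have "\<dots> \<le> (\<Sum>i\<in>{1..n}. (\<Sum>j\<in>{1..n}. C i j) * hnorm DS x)"
      by (rule sum_mono) (use c in blast)
    finally show ?thesis by (simp add: sum_distrib_right)
  qed
  show ?thesis unfolding bounded_ops_def using cl add sm bd by blast
qed

lemma triangular_linear: "A \<in> upper_tuples n H \<Longrightarrow> upper_triangular_op n H D A \<in> linear_ops DS DS"
  by (rule bounded_ops_linear[OF triangular_bounded])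

lemma triangular_Phi_minus_iff:
  assumes A: "A \<in> upper_tuples n H"
  shows "upper_triangular_op n H D A \<in> Phi_minus DS \<longleftrightarrow>
    almost_below DS (carrier DS) (op_range DS (upper_triangular_op n H D A))"
  using triangular_bounded[OF A]
    complex_hilbert_space.cfinite_deficiency_iff[OF ds_hilbert triangular_linear[OF A]]
  by (simp add: Phi_minus_def)

lemma diag_deficiency_iff:
  assumes "s \<in> {1..n}"
  shows "BNF_Cardinal_Arithmetic.cfinite (deficiency (H s) (D s)) \<longleftrightarrow>
    almost_below (H s) (carrier (H s)) (op_range (H s) (D s))"
  by (rule complex_hilbert_space.cfinite_deficiency_iff[OF summand[OF assms] diag_linear[OF assms]])

text \<open>The sum of the first \<open>m\<close> summands, inside the whole direct sum.\<close>

definition initial :: "nat \<Rightarrow> (nat \<Rightarrow> 'a) set" where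
  "initial m = {x \<in> carrier DS. \<forall>j\<in>{Suc m..n}. x j = \<zero>\<^bsub>H j\<^esub>}"

lemma subspace_initial: "subspace_of DS (initial m)"
proof (rule DS.subspaceI)
  show "initial m \<subseteq> carrier DS" by (auto simp: initial_def)
  show "\<zero>\<^bsub>DS\<^esub> \<in> initial m" using ds_closed(1) by (auto simp: initial_def ds_zero)
  fix x assume x: "x \<in> initial m"
  then have xc: "x \<in> carrier DS" by (simp add: initial_def)
  show "c \<odot>\<^bsub>DS\<^esub> x \<in> initial m" for c
    unfolding initial_def
  proof (intro CollectI conjI ballI)
    fix j assume j: "j \<in> {Suc m..n}"
    then have "j \<in> {1..n}" by auto
    then interpret complex_hilbert_space "H j" by (rule summand)
    show "(c \<odot>\<^bsub>DS\<^esub> x) j = \<zero>\<^bsub>H j\<^esub>" using x j \<open>j \<in> {1..n}\<close> by (simp add: initial_def ds_smult)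
  qed (use ds_closed xc in blast)
  fix y assume y: "y \<in> initial m"
  then have yc: "y \<in> carrier DS" by (simp add: initial_def)
  show "x \<oplus>\<^bsub>DS\<^esub> y \<in> initial m"
    unfolding initial_def
  proof (intro CollectI conjI ballI)
    fix j assume j: "j \<in> {Suc m..n}"
    then have "j \<in> {1..n}" by auto
    then interpret complex_hilbert_space "H j" by (rule summand)
    show "(x \<oplus>\<^bsub>DS\<^esub> y) j = \<zero>\<^bsub>H j\<^esub>" using x y j \<open>j \<in> {1..n}\<close> by (simp add: initial_def ds_add)
  qed (use ds_closed xc yc in blast)
qed

lemma initial_n: "initial n = carrier DS"
  by (auto simp: initial_def)

lemma initial_split:
  assumes x: "x \<in> initial (Suc m)" and m: "Suc m \<in> {1..n}"
  shows "x \<ominus>\<^bsub>DS\<^esub> incl (Suc m) (x (Suc m)) \<in> initial m"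
    and "x = (x \<ominus>\<^bsub>DS\<^esub> incl (Suc m) (x (Suc m))) \<oplus>\<^bsub>DS\<^esub> incl (Suc m) (x (Suc m))"
proof -
  have xc: "x \<in> carrier DS" using x by (simp add: initial_def)
  have ic: "incl (Suc m) (x (Suc m)) \<in> carrier DS"
    using linear_opsD(1)[OF incl_linear[OF m] ds_mem[OF xc m]] .
  show "x = (x \<ominus>\<^bsub>DS\<^esub> incl (Suc m) (x (Suc m))) \<oplus>\<^bsub>DS\<^esub> incl (Suc m) (x (Suc m))"
    using xc ic by (intro DS.cinner_ext) (auto simp: DS.cinner_left)
  show "x \<ominus>\<^bsub>DS\<^esub> incl (Suc m) (x (Suc m)) \<in> initial m"
    unfolding initial_def
  proof (intro CollectI conjI ballI)
    fix j assume j: "j \<in> {Suc m..n}"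
    then have j1: "j \<in> {1..n}" by auto
    then interpret complex_hilbert_space "H j" by (rule summand)
    have "x j = incl (Suc m) (x (Suc m)) j"
      using x j j1 by (cases "j = Suc m") (auto simp: initial_def incl_apply)
    then show "(x \<ominus>\<^bsub>DS\<^esub> incl (Suc m) (x (Suc m))) j = \<zero>\<^bsub>H j\<^esub>"
      using ds_diff[OF xc ic j1] ds_mem[OF xc j1] by (simp add: minus_eq r_neg)
  qed (use xc ic in simp)
qed

text \<open>In row \<open>m\<close> the entries before the diagonal vanish by triangularity, and those after it meet
  zero coordinates.\<close>

lemma triangular_initial:
  assumes A: "A \<in> upper_tuples n H" and x: "x \<in> initial m" and m: "m \<in> {1..n}"
  shows "upper_triangular_op n H D A x m = D m (x m)"
proof -
  interpret complex_hilbert_space "H m" using m by (rule summand)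
  have xc: "x \<in> carrier DS" using x by (simp add: initial_def)
  have "upper_triangular_op n H D A x m = upper_entry H D A m m (x m)"
    unfolding triangular_apply[OF m]
  proof (rule finsum_eq_single)
    show "upper_entry H D A m m (x m) \<in> carrier (H m)" by (rule entry_mem[OF A m m xc])
    fix j assume j: "j \<in> {1..n}" "j \<noteq> m"
    show "upper_entry H D A m j (x j) = \<zero>\<^bsub>H m\<^esub>"
    proof (cases "j < m")
      case True then show ?thesis by (simp add: upper_entry_def)
    next
      case False
      then have "x j = \<zero>\<^bsub>H j\<^esub>" using x j by (simp add: initial_def)
      then show ?thesis
        using linear_ops_zero[OF entry_linear[OF A m j(1)] summand_pre[OF j(1)] summand_pre[OF m]] by simp
    qed
  qed (use m in auto)
  then show ?thesis by (simp add: upper_entry_def)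
qed

lemma triangular_incl:
  assumes A: "A \<in> upper_tuples n H" and s: "s \<in> {1..n}" and a: "a \<in> carrier (H s)" and i: "i \<in> {1..n}"
  shows "upper_triangular_op n H D A (incl s a) i = upper_entry H D A i s a"
proof -
  interpret complex_hilbert_space "H i" using i by (rule summand)
  have ic: "incl s a \<in> carrier DS" using linear_opsD(1)[OF incl_linear[OF s] a] .
  have "upper_triangular_op n H D A (incl s a) i = upper_entry H D A i s (incl s a s)"
    unfolding triangular_apply[OF i]
  proof (rule finsum_eq_single)
    show "upper_entry H D A i s (incl s a s) \<in> carrier (H i)" by (rule entry_mem[OF A i s ic])
    fix j assume j: "j \<in> {1..n}" "j \<noteq> s"
    then show "upper_entry H D A i j (incl s a j) = \<zero>\<^bsub>H i\<^esub>"
      using linear_ops_zero[OF entry_linear[OF A i j(1)] summand_pre[OF j(1)] summand_pre[OF i]]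
      by (simp add: incl_apply)
  qed (use s in auto)
  then show ?thesis using s by (simp add: incl_apply)
qed

lemma component_linear:
  assumes A: "A \<in> upper_tuples n H" and s: "s \<in> {1..n}"
  shows "(\<lambda>x. upper_triangular_op n H D A x s) \<in> linear_ops DS (H s)"
  unfolding linear_ops_def
  using linear_opsD[OF triangular_linear[OF A]] linear_opsD[OF proj_linear[OF s]] by simp

section \<open>Finite codimension passes to the diagonal entries\<close>

text \<open>Decreasing \<open>m\<close> by one adds the homogeneous equation in row \<open>m\<close>, which is how these spaces are
  compared with \<^const>\<open>initial\<close>.\<close>

definition tail_kernel :: "(nat \<Rightarrow> nat \<Rightarrow> 'a \<Rightarrow> 'a) \<Rightarrow> nat \<Rightarrow> (nat \<Rightarrow> 'a) set" where
  "tail_kernel A m = {x \<in> carrier DS. \<forall>i\<in>{Suc m..n}. upper_triangular_op n H D A x i = \<zero>\<^bsub>H i\<^esub>}"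

text \<open>Downward induction on \<open>k\<close>. Assuming the claim for \<open>s = m + 1\<close>, imposing the equation in row
  \<open>s\<close> restricts the solutions, up to finite dimension, to those vectors \<open>x\<close> supported in the first
  \<open>s\<close> coordinates with \<open>D\<^sub>s x\<^sub>s = 0\<close>. Splitting off the coordinate \<open>x\<^sub>s\<close>, which ranges over a
  finite dimensional kernel, leaves a vector supported in the first \<open>m\<close> coordinates.\<close>

lemma tail_kernel_almost_below_initial:
  assumes A: "A \<in> upper_tuples n H" and k: "k \<le> n"
    and fin: "\<And>j. j \<in> {Suc k..n} \<Longrightarrow> \<not> cinfinite (nullity (H j) (D j))"
  shows "almost_below DS (tail_kernel A k) (initial k)"
  using k
proof (induct rule: inc_induct)
  case base
  show ?case by (rule almost_below.below) (auto simp: initial_n tail_kernel_def)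
next
  case (step m)
  let ?T = "upper_triangular_op n H D A"
  define s where "s = Suc m"
  have s: "s \<in> {1..n}" "s \<in> {Suc k..n}" using step by (auto simp: s_def)
  note pre = summand_pre[OF s(1)]
  interpret S: complex_hilbert_space "H s" using s(1) by (rule summand)
  define N where "N = a_kernel (H s) (H s) (D s)"
  define Z where "Z = {x \<in> carrier DS. ?T x s \<in> {\<zero>\<^bsub>H s\<^esub>}}"
  define W where "W = {x \<in> initial s. D s (x s) = \<zero>\<^bsub>H s\<^esub>}"
  have Z: "subspace_of DS Z"
    unfolding Z_def
    by (rule subspace_vimage[OF component_linear[OF A s(1)] ds_prehilbert pre DS.subspace_carrier S.subspace_zero])
  have id: "(\<lambda>x. x) \<in> linear_ops DS DS" by (simp add: linear_ops_def)
  have ZZ: "almost_below DS {x \<in> Z. x \<in> tail_kernel A s} {x \<in> Z. x \<in> initial s}"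
    by (rule almost_below_vimage[OF id ds_prehilbert ds_prehilbert Z _ subspace_initial])
      (use step(3) in \<open>simp add: s_def\<close>)
  have KZ: "tail_kernel A m \<subseteq> {x \<in> Z. x \<in> tail_kernel A s}"
    using s by (auto simp: tail_kernel_def Z_def s_def)
  have ZW: "{x \<in> Z. x \<in> initial s} \<subseteq> W"
    using triangular_initial[OF A _ s(1)] by (auto simp: Z_def W_def)
  have KW: "almost_below DS (tail_kernel A m) W"
    by (rule almost_below_mono_left[OF almost_below_mono_right[OF ZZ ZW] KZ])
  have "almost_below (H s) N {\<zero>\<^bsub>H s\<^esub>}"
    unfolding N_def
    by (rule S.almost_below_zero_if_finite_dim[OF subspace_kernel[OF diag_linear[OF s(1)] pre pre]])
      (use fin[OF s(2)] in \<open>simp add: nullity_def\<close>)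
  then have "almost_below DS (incl s ` N) (incl s ` {\<zero>\<^bsub>H s\<^esub>})"
    by (rule almost_below_image[OF incl_linear[OF s(1)] pre]) simp
  moreover have "incl s ` {\<zero>\<^bsub>H s\<^esub>} \<subseteq> initial m"
    using linear_ops_zero[OF incl_linear[OF s(1)] pre ds_prehilbert] DS.subspaceD(3)[OF subspace_initial]
    by simp
  ultimately have N: "almost_below DS (incl s ` N) (initial m)"
    by (rule almost_below_mono_right)
  have "almost_below DS W (initial m)"
  proof (rule DS.almost_below_sum[OF almost_below.below[OF order_refl] N subspace_initial])
    fix x assume x: "x \<in> W"
    then have xi: "x \<in> initial (Suc m)" "x \<in> carrier DS" by (auto simp: W_def s_def initial_def)
    have "x s \<in> N" using x ds_mem[OF xi(2) s(1)] by (simp add: N_def W_def kernel_alt)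
    then show "\<exists>u1\<in>initial m. \<exists>u2\<in>incl s ` N. x = u1 \<oplus>\<^bsub>DS\<^esub> u2"
      using initial_split[OF xi(1) s(1)[unfolded s_def]] unfolding s_def[symmetric] by blast
  qed
  then show ?case
    by (rule DS.almost_below_trans[OF KW]) (rule DS.subspaceD(1)[OF subspace_initial])
qed

text \<open>A vector \<open>a\<close> of the \<open>k\<close>-th summand that lies in the range of \<open>T\<close> is \<open>(T x)\<^sub>k\<close> for some \<open>x\<close>
  solving all later equations; up to finite dimension such an \<open>x\<close> is supported in the first \<open>k\<close>
  coordinates, where \<open>(T x)\<^sub>k = D\<^sub>k x\<^sub>k\<close>.\<close>

lemma diag_finite_codim:
  assumes A: "A \<in> upper_tuples n H" and k: "k \<in> {1..n}"
    and fin: "\<And>j. j \<in> {Suc k..n} \<Longrightarrow> \<not> cinfinite (nullity (H j) (D j))"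
    and ab: "almost_below DS (carrier DS) (op_range DS (upper_triangular_op n H D A))"
  shows "almost_below (H k) (carrier (H k)) (op_range (H k) (D k))"
proof -
  let ?T = "upper_triangular_op n H D A"
  note pre = summand_pre[OF k]
  interpret S: complex_hilbert_space "H k" using k by (rule summand)
  have RT: "subspace_of DS (op_range DS ?T)"
    by (rule subspace_image[OF triangular_linear[OF A] ds_prehilbert ds_prehilbert DS.subspace_carrier])
  have "almost_below (H k) {a \<in> carrier (H k). incl k a \<in> carrier DS}
      {a \<in> carrier (H k). incl k a \<in> op_range DS ?T}"
    by (rule almost_below_vimage[OF incl_linear[OF k] pre ds_prehilbert S.subspace_carrier ab RT])
  then have "almost_below (H k) (carrier (H k)) {a \<in> carrier (H k). incl k a \<in> op_range DS ?T}"
    by (rule almost_below_mono_left) (use linear_opsD(1)[OF incl_linear[OF k]] in blast)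
  then have 1: "almost_below (H k) (carrier (H k)) ((\<lambda>x. ?T x k) ` tail_kernel A k)"
  proof (rule almost_below_mono_right)
    show "{a \<in> carrier (H k). incl k a \<in> op_range DS ?T} \<subseteq> (\<lambda>x. ?T x k) ` tail_kernel A k"
    proof
      fix a assume "a \<in> {a \<in> carrier (H k). incl k a \<in> op_range DS ?T}"
      then obtain x where x: "x \<in> carrier DS" "?T x = incl k a" by auto
      have "x \<in> tail_kernel A k"
        using x by (simp add: tail_kernel_def incl_apply)
      moreover have "?T x k = a" using x(2) incl_apply[OF k, of k a] by simp
      ultimately show "a \<in> (\<lambda>x. ?T x k) ` tail_kernel A k" by blast
    qed
  qed
  have "almost_below (H k) ((\<lambda>x. ?T x k) ` tail_kernel A k) ((\<lambda>x. ?T x k) ` initial k)"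
    by (rule almost_below_image[OF component_linear[OF A k] ds_prehilbert
          tail_kernel_almost_below_initial[OF A _ fin]])
      (use k in \<open>auto simp: initial_def\<close>)
  moreover have "(\<lambda>x. ?T x k) ` initial k \<subseteq> op_range (H k) (D k)"
    using triangular_initial[OF A _ k] ds_mem[OF _ k] by (auto simp: initial_def)
  ultimately have 2: "almost_below (H k) ((\<lambda>x. ?T x k) ` tail_kernel A k) (op_range (H k) (D k))"
    by (rule almost_below_mono_right)
  show ?thesis
    by (rule S.almost_below_trans[OF 1 2]) (use linear_opsD(1)[OF diag_linear[OF k]] in blast)
qed

section \<open>Bidiagonal completions\<close>

abbreviation ker :: "nat \<Rightarrow> 'a set" where
  "ker s \<equiv> a_kernel (H s) (H s) (D s)"

text \<open>What the entry in position \<open>(s, s + 1)\<close> has to achieve. The last condition says that \<open>J\<close> restricted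
  to the kernel of the next diagonal entry fills up the range of \<open>D\<^sub>s\<close> to finite codimension; the
  middle one says that \<open>J\<close> takes no values outside the space filled up in this way. Both the zero
  operator and an operator onto the orthogonal complement of the range can satisfy them.\<close>

definition connecting_op :: "nat \<Rightarrow> ('a \<Rightarrow> 'a) \<Rightarrow> bool" where
  "connecting_op s J \<longleftrightarrow> J \<in> bounded_ops (H (Suc s)) (H s) \<and>
     (\<forall>x\<in>carrier (H (Suc s)). \<exists>a\<in>carrier (H s). \<exists>b\<in>ker (Suc s). J x = D s a \<oplus>\<^bsub>H s\<^esub> J b) \<and>
     almost_below (H s) (carrier (H s))
       {D s a \<oplus>\<^bsub>H s\<^esub> J b |a b. a \<in> carrier (H s) \<and> b \<in> ker (Suc s)}"

text \<open>On the \<open>s\<close>-th summand \<open>T\<close> acts as \<open>D\<^sub>s\<close> into the same summand plus \<open>J\<^sub>s\<^sub>-\<^sub>1\<close> into the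
  preceding one. On the kernel of \<open>D\<^sub>s\<close> only the second part remains, so \<open>J\<^sub>s\<^sub>-\<^sub>1\<close> of the kernel, as
  a subset of summand \<open>s - 1\<close>, lies in the range of \<open>T\<close>. For a general vector of summand \<open>s\<close>, the part
  in summand \<open>s - 1\<close> lies in the range by induction on \<open>s\<close> and may be subtracted, so the range of \<open>D\<^sub>s\<close>
  in summand \<open>s\<close> lies in the range of \<open>T\<close> as well.\<close>

lemma bidiagonal_finite_codim:
  assumes conn: "\<And>s. s \<in> {1..<n} \<Longrightarrow> connecting_op s (J s)"
    and last: "almost_below (H n) (carrier (H n)) (op_range (H n) (D n))"
  shows "\<exists>A\<in>upper_tuples n H. almost_below DS (carrier DS) (op_range DS (upper_triangular_op n H D A))"
proof -
  have J: "J s \<in> bounded_ops (H (Suc s)) (H s)" if "s \<in> {1..<n}" for s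
    using conn[OF that] by (simp add: connecting_op_def)
  have J_range: "\<exists>a\<in>carrier (H s). \<exists>b\<in>ker (Suc s). J s x = D s a \<oplus>\<^bsub>H s\<^esub> J s b"
    if "s \<in> {1..<n}" "x \<in> carrier (H (Suc s))" for s x
    using conn[OF that(1)] that(2) by (simp add: connecting_op_def)
  have codim: "almost_below (H s) (carrier (H s))
      {D s a \<oplus>\<^bsub>H s\<^esub> J s b |a b. a \<in> carrier (H s) \<and> b \<in> ker (Suc s)}"
    if "s \<in> {1..<n}" for s
    using conn[OF that] by (simp add: connecting_op_def)
  define A where "A i j = (if j = Suc i then J i else (\<lambda>_. \<zero>\<^bsub>H i\<^esub>))" for i j
  have A: "A \<in> upper_tuples n H"
    unfolding upper_tuples_def
  proof (intro CollectI allI impI)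
    fix i j assume ij: "1 \<le> i \<and> i < j \<and> j \<le> n"
    show "A i j \<in> bounded_ops (H j) (H i)"
    proof (cases "j = Suc i")
      case True
      then show ?thesis using ij J[of i] by (simp add: A_def)
    next
      case False
      have "i \<in> {1..n}" "j \<in> {1..n}" using ij by auto
      then show ?thesis using False zero_bounded[OF summand summand] by (simp add: A_def)
    qed
  qed
  let ?T = "upper_triangular_op n H D A"
  define R where "R = op_range DS ?T"
  note TL = triangular_linear[OF A]
  have R: "subspace_of DS R"
    unfolding R_def by (rule subspace_image[OF TL ds_prehilbert ds_prehilbert DS.subspace_carrier])
  note RD = DS.subspaceD[OF R]
  have TR: "?T (incl s a) \<in> R" if "s \<in> {1..n}" "a \<in> carrier (H s)" for s a
    unfolding R_def using linear_opsD(1)[OF incl_linear[OF that(1)] that(2)] by blast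
  have Tc: "?T (incl s a) \<in> carrier DS" if "s \<in> {1..n}" "a \<in> carrier (H s)" for s a
    using TR[OF that] RD(2) by blast
  have Jker: "incl s (J s b) \<in> R"
    if s: "s \<in> {1..<n}" and b: "b \<in> a_kernel (H (Suc s)) (H (Suc s)) (D (Suc s))" for s b
  proof -
    have s1: "Suc s \<in> {1..n}" "s \<in> {1..n}" using s by auto
    have b': "b \<in> carrier (H (Suc s))" "D (Suc s) b = \<zero>\<^bsub>H (Suc s)\<^esub>" using b by (auto simp: kernel_alt)
    have Jb: "J s b \<in> carrier (H s)" using linear_opsD(1)[OF bounded_ops_linear[OF J[OF s]] b'(1)] .
    have "?T (incl (Suc s) b) = incl s (J s b)"
    proof (rule ds_eqI)
      fix i assume i: "i \<in> {1..n}"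
      show "?T (incl (Suc s) b) i = incl s (J s b) i"
        unfolding triangular_incl[OF A s1(1) b'(1) i] incl_apply[OF i]
        using b'(2) by (auto simp: upper_entry_def A_def)
    qed (use Tc[OF s1(1) b'(1)] linear_opsD(1)[OF incl_linear[OF s1(2)] Jb] in auto)
    then show ?thesis using TR[OF s1(1) b'(1)] by simp
  qed
  have Dran: "s \<in> {1..n} \<Longrightarrow> \<forall>a\<in>carrier (H s). incl s (D s a) \<in> R" for s
  proof (induct s)
    case 0 then show ?case by simp
  next
    case (Suc m)
    show ?case
    proof
      fix a assume a: "a \<in> carrier (H (Suc m))"
      note s = Suc(2)
      have Da: "D (Suc m) a \<in> carrier (H (Suc m))" using linear_opsD(1)[OF diag_linear[OF s] a] .
      have Dc: "incl (Suc m) (D (Suc m) a) \<in> carrier DS"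
        using linear_opsD(1)[OF incl_linear[OF s] Da] .
      show "incl (Suc m) (D (Suc m) a) \<in> R"
      proof (cases "m = 0")
        case True
        have "?T (incl (Suc m) a) = incl (Suc m) (D (Suc m) a)"
        proof (rule ds_eqI)
          fix i assume i: "i \<in> {1..n}"
          show "?T (incl (Suc m) a) i = incl (Suc m) (D (Suc m) a) i"
            unfolding triangular_incl[OF A s a i] incl_apply[OF i]
            using i True by (auto simp: upper_entry_def)
        qed (use Tc[OF s a] Dc in auto)
        then show ?thesis using TR[OF s a] by simp
      next
        case False
        then have m: "m \<in> {1..n}" "m \<in> {1..<n}" using s by auto
        interpret M: complex_hilbert_space "H m" using m(1) by (rule summand)
        obtain a' b where ab: "a' \<in> carrier (H m)" "b \<in> a_kernel (H (Suc m)) (H (Suc m)) (D (Suc m))"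
          "J m a = D m a' \<oplus>\<^bsub>H m\<^esub> J m b"
          using J_range[OF m(2) a] by blast
        have Jm: "J m x \<in> carrier (H m)" if "x \<in> carrier (H (Suc m))" for x
          using linear_opsD(1)[OF bounded_ops_linear[OF J[OF m(2)]] that] .
        have bc: "b \<in> carrier (H (Suc m))" using ab(2) by (simp add: kernel_alt)
        have Dm: "D m a' \<in> carrier (H m)" using linear_opsD(1)[OF diag_linear[OF m(1)] ab(1)] .
        note IL = linear_opsD[OF incl_linear[OF m(1)]]
        have "incl m (J m a) = incl m (D m a') \<oplus>\<^bsub>DS\<^esub> incl m (J m b)"
          unfolding ab(3) by (rule IL(2)[OF Dm Jm[OF bc]])
        also have "\<dots> \<in> R"
          by (rule RD(4)) (use Suc(1)[OF m(1)] ab(1) Jker[OF m(2) ab(2)] in auto)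
        finally have JR: "incl m (J m a) \<in> R" .
        have Jc: "incl m (J m a) \<in> carrier DS" using JR RD(2) by blast
        have "incl (Suc m) (D (Suc m) a) = ?T (incl (Suc m) a) \<ominus>\<^bsub>DS\<^esub> incl m (J m a)"
        proof (rule ds_eqI)
          fix i assume i: "i \<in> {1..n}"
          then interpret I: complex_hilbert_space "H i" by (rule summand)
          have "?T (incl (Suc m) a) i \<ominus>\<^bsub>H i\<^esub> incl m (J m a) i = incl (Suc m) (D (Suc m) a) i"
          proof -
            consider "i = m" | "i = Suc m" | "i \<noteq> m" "i \<noteq> Suc m" by blast
            then show ?thesis
              unfolding triangular_incl[OF A s a i] incl_apply[OF i]
            proof cases
              case 1
              then show "upper_entry H D A i (Suc m) a \<ominus>\<^bsub>H i\<^esub> (if i = m then J m a else \<zero>\<^bsub>H i\<^esub>) =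
                  (if i = Suc m then D (Suc m) a else \<zero>\<^bsub>H i\<^esub>)"
                using Jm[OF a] by (simp add: upper_entry_def A_def M.minus_eq M.r_neg)
            next
              case 2
              then show "upper_entry H D A i (Suc m) a \<ominus>\<^bsub>H i\<^esub> (if i = m then J m a else \<zero>\<^bsub>H i\<^esub>) =
                  (if i = Suc m then D (Suc m) a else \<zero>\<^bsub>H i\<^esub>)"
                using Da I.diff_zero by (simp add: upper_entry_def)
            next
              case 3
              then show "upper_entry H D A i (Suc m) a \<ominus>\<^bsub>H i\<^esub> (if i = m then J m a else \<zero>\<^bsub>H i\<^esub>) =
                  (if i = Suc m then D (Suc m) a else \<zero>\<^bsub>H i\<^esub>)"
                using I.diff_zero by (simp add: upper_entry_def A_def)
            qed
          qed
          then show "incl (Suc m) (D (Suc m) a) i = (?T (incl (Suc m) a) \<ominus>\<^bsub>DS\<^esub> incl m (J m a)) i"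
            using ds_diff[OF Tc[OF s a] Jc i] by simp
        qed (use Dc Tc[OF s a] Jc in auto)
        also have "\<dots> \<in> R" by (rule RD(5)[OF TR[OF s a] JR])
        finally show ?thesis .
      qed
    qed
  qed
  have summands: "almost_below DS (incl s ` carrier (H s)) R" if s: "s \<in> {1..n}" for s
  proof (cases "s = n")
    case True
    have "almost_below DS (incl s ` carrier (H s)) (incl s ` op_range (H s) (D s))"
      by (rule almost_below_image[OF incl_linear[OF s] summand_pre[OF s]])
        (use last True linear_opsD(1)[OF diag_linear[OF s]] in blast)+
    moreover have "incl s ` op_range (H s) (D s) \<subseteq> R" using Dran[OF s] by blast
    ultimately show ?thesis by (rule almost_below_mono_right)
  next
    case False
    then have s1: "s \<in> {1..<n}" using s by auto
    interpret S: complex_hilbert_space "H s" using s by (rule summand)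
    let ?M = "{D s a \<oplus>\<^bsub>H s\<^esub> J s b |a b. a \<in> carrier (H s) \<and> b \<in> a_kernel (H (Suc s)) (H (Suc s)) (D (Suc s))}"
    have c: "D s a \<in> carrier (H s)" "J s b \<in> carrier (H s)"
      if "a \<in> carrier (H s)" "b \<in> a_kernel (H (Suc s)) (H (Suc s)) (D (Suc s))" for a b
      using that linear_opsD(1)[OF diag_linear[OF s]] linear_opsD(1)[OF bounded_ops_linear[OF J[OF s1]]]
      by (auto simp: kernel_alt)
    have "almost_below DS (incl s ` carrier (H s)) (incl s ` ?M)"
      by (rule almost_below_image[OF incl_linear[OF s] summand_pre[OF s] codim[OF s1]]) (use c in auto)
    moreover have "incl s ` ?M \<subseteq> R"
    proof
      fix y assume "y \<in> incl s ` ?M"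
      then obtain a b where ab: "a \<in> carrier (H s)" "b \<in> a_kernel (H (Suc s)) (H (Suc s)) (D (Suc s))"
        "y = incl s (D s a \<oplus>\<^bsub>H s\<^esub> J s b)" by auto
      have "y = incl s (D s a) \<oplus>\<^bsub>DS\<^esub> incl s (J s b)"
        unfolding ab(3) by (rule linear_opsD(2)[OF incl_linear[OF s] c[OF ab(1,2)]])
      also have "\<dots> \<in> R" by (rule RD(4)) (use Dran[OF s] ab(1) Jker[OF s1 ab(2)] in auto)
      finally show "y \<in> R" .
    qed
    ultimately show ?thesis by (rule almost_below_mono_right)
  qed
  have "m \<le> n \<Longrightarrow> almost_below DS (initial m) R" for m
  proof (induct m)
    case 0
    have "initial 0 \<subseteq> R"
    proof
      fix x assume x: "x \<in> initial 0"
      have "x = \<zero>\<^bsub>DS\<^esub>"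
        by (rule ds_eqI) (use x ds_closed(1) in \<open>auto simp: initial_def ds_zero\<close>)
      then show "x \<in> R" using RD(3) by simp
    qed
    then show ?case by (rule almost_below.below)
  next
    case (Suc m)
    then have s: "Suc m \<in> {1..n}" and IH: "almost_below DS (initial m) R" by auto
    show ?case
    proof (rule DS.almost_below_sum[OF IH summands[OF s] R])
      fix x assume x: "x \<in> initial (Suc m)"
      then have "x (Suc m) \<in> carrier (H (Suc m))" using ds_mem[OF _ s] by (simp add: initial_def)
      then show "\<exists>u1\<in>initial m. \<exists>u2\<in>incl (Suc m) ` carrier (H (Suc m)). x = u1 \<oplus>\<^bsub>DS\<^esub> u2"
        using initial_split[OF x s] by blast
    qed
  qed
  from this[of n] have "almost_below DS (carrier DS) R" by (simp add: initial_n)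
  then show ?thesis using A unfolding R_def by blast
qed

text \<open>An operator onto the orthogonal complement \<open>R\<^sup>\<bottom>\<close> of the range that maps the kernel onto
  \<open>R\<^sup>\<bottom>\<close> has the required properties, because the space is the sum of \<open>R\<close> and \<open>R\<^sup>\<bottom>\<close>.\<close>

lemma connecting_op_exists:
  assumes s: "s \<in> {1..<n}" and closed: "hclosed (H s) (op_range (H s) (D s))"
    and dim: "deficiency (H s) (D s) \<le>o nullity (H (Suc s)) (D (Suc s))"
  shows "\<exists>J. connecting_op s J"
proof -
  have s1: "s \<in> {1..n}" "Suc s \<in> {1..n}" using s by auto
  interpret S: complex_hilbert_space "H s" using s1(1) by (rule summand)
  interpret S': complex_hilbert_space "H (Suc s)" using s1(2) by (rule summand)
  note pre = summand_pre[OF s1(1)] summand_pre[OF s1(2)]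
  define R where "R = op_range (H s) (D s)"
  define N where "N = a_kernel (H (Suc s)) (H (Suc s)) (D (Suc s))"
  have R: "subspace_of (H s) R"
    unfolding R_def by (rule subspace_image[OF diag_linear[OF s1(1)] pre(1,1) S.subspace_carrier])
  have RH: "R \<subseteq> carrier (H s)" by (rule S.subspaceD(1)[OF R])
  have "hilbert_dim (H s) (orth_compl (H s) R) \<le>o hilbert_dim (H (Suc s)) N"
    using dim closed unfolding deficiency_def nullity_def R_def N_def by simp
  then obtain J where J: "J \<in> bounded_ops (H (Suc s)) (H s)"
    "J ` carrier (H (Suc s)) \<subseteq> orth_compl (H s) R" "orth_compl (H s) R \<subseteq> J ` N"
    using bounded_op_onto[OF summand[OF s1(1)] summand[OF s1(2)] S.subspace_orth_compl[OF RH]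
        S.hclosed_orth_compl[OF RH] subspace_kernel[OF diag_linear[OF s1(2)] pre(2,2)]
        hclosed_kernel[OF diag[OF s1(2)] pre(2,2)]]
    unfolding N_def by blast
  have D0: "D s \<zero>\<^bsub>H s\<^esub> = \<zero>\<^bsub>H s\<^esub>" by (rule linear_ops_zero[OF diag_linear[OF s1(1)] pre(1,1)])
  have 1: "\<exists>a\<in>carrier (H s). \<exists>b\<in>N. J x = D s a \<oplus>\<^bsub>H s\<^esub> J b" if x: "x \<in> carrier (H (Suc s))" for x
  proof -
    obtain b where b: "b \<in> N" "J x = J b" using J(2,3) x by blast
    have "J b \<in> carrier (H s)" using linear_opsD(1)[OF bounded_ops_linear[OF J(1)] x] b(2) by simp
    then have "J x = D s \<zero>\<^bsub>H s\<^esub> \<oplus>\<^bsub>H s\<^esub> J b" using b(2) D0 by simp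
    then show ?thesis using b(1) S.zero_closed by blast
  qed
  have 2: "y \<in> {D s a \<oplus>\<^bsub>H s\<^esub> J b |a b. a \<in> carrier (H s) \<and> b \<in> N}" if y: "y \<in> carrier (H s)" for y
  proof -
    obtain r where r: "r \<in> R" "y \<ominus>\<^bsub>H s\<^esub> r \<in> orth_compl (H s) R"
      using S.orthogonal_projection[OF R closed[folded R_def] y] by blast
    obtain a where a: "a \<in> carrier (H s)" "r = D s a" using r(1) by (auto simp: R_def)
    obtain b where b: "b \<in> N" "y \<ominus>\<^bsub>H s\<^esub> r = J b" using r(2) J(3) by blast
    have "y = r \<oplus>\<^bsub>H s\<^esub> (y \<ominus>\<^bsub>H s\<^esub> r)"
      using y r(1) RH by (intro S.cinner_ext) (auto simp: S.cinner_left)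
    then have "y = D s a \<oplus>\<^bsub>H s\<^esub> J b" using a(2) b(2) by simp
    then show ?thesis using a(1) b(1) by blast
  qed
  have "connecting_op s J"
    unfolding connecting_op_def N_def[symmetric]
    by (intro conjI J(1) ballI 1 almost_below.below subsetI 2)
  then show ?thesis by (rule exI[of "connecting_op s"])
qed

lemma connecting_op_zero:
  assumes s: "s \<in> {1..<n}" and ab: "almost_below (H s) (carrier (H s)) (op_range (H s) (D s))"
  shows "connecting_op s (\<lambda>_. \<zero>\<^bsub>H s\<^esub>)"
  unfolding connecting_op_def
proof (intro conjI ballI)
  have s1: "s \<in> {1..n}" "Suc s \<in> {1..n}" using s by auto
  interpret S: complex_hilbert_space "H s" using s1(1) by (rule summand)
  interpret S': complex_hilbert_space "H (Suc s)" using s1(2) by (rule summand)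
  have zN: "\<zero>\<^bsub>H (Suc s)\<^esub> \<in> ker (Suc s)"
    using S'.subspaceD(3)[OF subspace_kernel[OF diag_linear[OF s1(2)] summand_pre[OF s1(2)] summand_pre[OF s1(2)]]] .
  have D0: "D s \<zero>\<^bsub>H s\<^esub> = \<zero>\<^bsub>H s\<^esub>"
    by (rule linear_ops_zero[OF diag_linear[OF s1(1)] summand_pre[OF s1(1)] summand_pre[OF s1(1)]])
  show "(\<lambda>_. \<zero>\<^bsub>H s\<^esub>) \<in> bounded_ops (H (Suc s)) (H s)"
    by (rule zero_bounded[OF summand[OF s1(2)] summand[OF s1(1)]])
  show "\<exists>a\<in>carrier (H s). \<exists>b\<in>ker (Suc s). \<zero>\<^bsub>H s\<^esub> = D s a \<oplus>\<^bsub>H s\<^esub> \<zero>\<^bsub>H s\<^esub>"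
    by (rule bexI[of _ "\<zero>\<^bsub>H s\<^esub>"], rule bexI[OF _ zN]) (simp_all add: D0)
  show "almost_below (H s) (carrier (H s)) {D s a \<oplus>\<^bsub>H s\<^esub> \<zero>\<^bsub>H s\<^esub> |a b. a \<in> carrier (H s) \<and> b \<in> ker (Suc s)}"
  proof (rule almost_below_mono_right[OF ab], rule subsetI)
    fix y assume "y \<in> op_range (H s) (D s)"
    then obtain a where a: "a \<in> carrier (H s)" "y = D s a" by auto
    then have "y = D s a \<oplus>\<^bsub>H s\<^esub> \<zero>\<^bsub>H s\<^esub>"
      using linear_opsD(1)[OF diag_linear[OF s1(1)] a(1)] by simp
    then show "y \<in> {D s a \<oplus>\<^bsub>H s\<^esub> \<zero>\<^bsub>H s\<^esub> |a b. a \<in> carrier (H s) \<and> b \<in> ker (Suc s)}"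
      using a(1) zN by blast
  qed
qed

end

section \<open>The characterisation\<close>

theorem theorem3p8:
  fixes n :: nat
    and H :: "nat \<Rightarrow> 'a hilbert"
    and D :: "nat \<Rightarrow> 'a \<Rightarrow> 'a"
  assumes "n \<ge> 2"
    and "\<And>s. s \<in> {1..n} \<Longrightarrow> complex_hilbert_space (H s)"
    and "\<And>s. s \<in> {1..n} \<Longrightarrow> infinite_dimensional (H s)"
    and "\<And>s. s \<in> {1..n} \<Longrightarrow> D s \<in> bounded_ops (H s) (H s)"
  shows
    "(D n \<in> Phi_minus (H n) \<and>
      ((\<forall>s\<in>{1..n-1}. hclosed (H s) (op_range (H s) (D s))) \<and>
       (\<forall>s\<in>{1..n-1}. deficiency (H s) (D s) \<le>o nullity (H (s+1)) (D (s+1)))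
       \<or> (\<forall>s\<in>{1..n-1}. D s \<in> Phi_minus (H s)))
      \<longrightarrow> (\<exists>A\<in>upper_tuples n H. upper_triangular_op n H D A \<in> Phi_minus (direct_sum n H)))
     \<and>
     ((\<exists>A\<in>upper_tuples n H. upper_triangular_op n H D A \<in> Phi_minus (direct_sum n H))
      \<longrightarrow> D n \<in> Phi_minus (H n) \<and>
        ((\<exists>j\<in>{2..n}. cinfinite (nullity (H j) (D j)) \<and>
            (\<forall>s\<in>{j..n-1}. BNF_Cardinal_Arithmetic.cfinite (deficiency (H s) (D s))))
         \<or> (\<forall>s\<in>{1..n-1}. D s \<in> Phi_minus (H s))))"
proof -
  interpret triangular_family n H D
    by (intro triangular_family.intro hilbert_family.intro triangular_family_axioms.intro assms(2,4))
  have nn: "n \<in> {1..n}" "1 \<le> n" using assms(1) by auto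
  have Phi: "D s \<in> Phi_minus (H s) \<longleftrightarrow> BNF_Cardinal_Arithmetic.cfinite (deficiency (H s) (D s))"
    if "s \<in> {1..n}" for s
    using diag[OF that] by (simp add: Phi_minus_def)
  have idx: "{1..n-1} = {1..<n}" using assms(1) by auto
  show ?thesis
  proof (intro conjI impI)
    assume i: "D n \<in> Phi_minus (H n) \<and>
      ((\<forall>s\<in>{1..n-1}. hclosed (H s) (op_range (H s) (D s))) \<and>
       (\<forall>s\<in>{1..n-1}. deficiency (H s) (D s) \<le>o nullity (H (s+1)) (D (s+1)))
       \<or> (\<forall>s\<in>{1..n-1}. D s \<in> Phi_minus (H s)))"
    then have last: "almost_below (H n) (carrier (H n)) (op_range (H n) (D n))"
      using Phi[OF nn(1)] diag_deficiency_iff[OF nn(1)] by simp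
    have "\<exists>J. connecting_op s J" if s: "s \<in> {1..<n}" for s
    proof (cases "\<forall>s\<in>{1..n-1}. D s \<in> Phi_minus (H s)")
      case True
      have s1: "s \<in> {1..n}" using s by auto
      have "almost_below (H s) (carrier (H s)) (op_range (H s) (D s))"
        using True s Phi[OF s1] diag_deficiency_iff[OF s1] unfolding idx by simp
      from connecting_op_zero[OF s this] show ?thesis by (rule exI[of "connecting_op s"])
    next
      case False
      then have "hclosed (H s) (op_range (H s) (D s))"
        "deficiency (H s) (D s) \<le>o nullity (H (Suc s)) (D (Suc s))"
        using i s unfolding idx by auto
      then show ?thesis by (rule connecting_op_exists[OF s])
    qed
    then obtain J where "\<And>s. s \<in> {1..<n} \<Longrightarrow> connecting_op s (J s)" by metis
    then have "\<exists>A\<in>upper_tuples n H. almost_below DS (carrier DS) (op_range DS (upper_triangular_op n H D A))"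
      using last by (rule bidiagonal_finite_codim)
    then show "\<exists>A\<in>upper_tuples n H. upper_triangular_op n H D A \<in> Phi_minus (direct_sum n H)"
      using triangular_Phi_minus_iff by metis
  next
    assume "\<exists>A\<in>upper_tuples n H. upper_triangular_op n H D A \<in> Phi_minus (direct_sum n H)"
    then obtain A where A: "A \<in> upper_tuples n H"
      and ab: "almost_below DS (carrier DS) (op_range DS (upper_triangular_op n H D A))"
      using triangular_Phi_minus_iff by metis
    show Dn: "D n \<in> Phi_minus (H n)"
      using diag_finite_codim[OF A nn(1) _ ab] diag_deficiency_iff[OF nn(1)] Phi[OF nn(1)] by simp
    show "(\<exists>j\<in>{2..n}. cinfinite (nullity (H j) (D j)) \<and>
            (\<forall>s\<in>{j..n-1}. BNF_Cardinal_Arithmetic.cfinite (deficiency (H s) (D s))))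
         \<or> (\<forall>s\<in>{1..n-1}. D s \<in> Phi_minus (H s))"
    proof (subst disj_commute, rule disjCI)
      assume no: "\<not> (\<exists>j\<in>{2..n}. cinfinite (nullity (H j) (D j)) \<and>
            (\<forall>s\<in>{j..n-1}. BNF_Cardinal_Arithmetic.cfinite (deficiency (H s) (D s))))"
      have "\<forall>s\<in>{1..n}. BNF_Cardinal_Arithmetic.cfinite (deficiency (H s) (D s))"
        using nn(2)
      proof (induct rule: inc_induct)
        case base
        then show ?case using Dn Phi[OF nn(1)] by simp
      next
        case (step m)
        have m: "m \<in> {1..n}" using step by auto
        have "\<not> cinfinite (nullity (H j) (D j))" if j: "j \<in> {Suc m..n}" for j
        proof
          assume "cinfinite (nullity (H j) (D j))"
          moreover have "j \<in> {2..n}" using j m by auto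
          moreover have "\<forall>s\<in>{j..n-1}. BNF_Cardinal_Arithmetic.cfinite (deficiency (H s) (D s))"
            using step(3) j by auto
          ultimately show False using no by blast
        qed
        then have "BNF_Cardinal_Arithmetic.cfinite (deficiency (H m) (D m))"
          using diag_finite_codim[OF A m _ ab] diag_deficiency_iff[OF m] by blast
        moreover have "{m..n} = insert m {Suc m..n}" using m by auto
        ultimately show ?case using step(3) by simp
      qed
      then show "\<forall>s\<in>{1..n-1}. D s \<in> Phi_minus (H s)"
        using Phi unfolding idx by simp
    qed
  qed
qed

end
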